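(* Let $n$ be sufficiently large, let $\mathbf k=(k_2,k_3,k_4,k_5)$ be the exact signed witness profile (defined in the context), which has $k_{\mathrm{co}}=\lceil r_4^{\mathrm{co}}\rceil+16$ classes, and let $Z^{\mathrm{sgn}}_{\mathbf k}$ be its signed witness count in $G_n\sim G(n,1/2)$. For every overlap matrix $r\in\mathcal R(\mathbf s,\mathbf t)$, the normalized local factor $A_\zeta(r)$ of the corresponding pair of partitions is $$A_\zeta(r)=2^{W+c(H)-|V(H)|}=\Big(\prod_{a,b}g(r_{ab})\Big)2^{\beta(H)},$$ where $H=H(r)$, $W=\sum_{a,b}\binom{r_{ab}}2$, and $$g(0)=g(1)=g(2)=1,\qquad g(x)=2^{\binom x2-1}\quad(x\ge3).$$ Consequently $$\frac{\mathbb E[(Z^{\mathrm{sgn}}_{\mathbf k})^2]}{(\mathbb E Z^{\mathrm{sgn}}_{\mathbf k})^2}=\sum_{r\in\mathcal R(\mathbf s,\mathbf t)}p(r)A_\zeta(r),\qquad p(r)=\frac{\prod_a s_a!\prod_b t_b!}{n!\prod_{a,b}r_{ab}!}.$$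
   Context: $G_n\sim G(n,1/2)$ is the random graph on $[n]=\{1,\dots,n\}$ in which each pair is an edge independently with probability $1/2$. Logarithms without a base are natural. **The profile.** Put $\alpha_0:=2\log_2 n-2\log_2\log_2 n+2\log_2(\mathrm e/2)+1$, $\alpha:=\lfloor\alpha_0\rfloor$, $s_0:=\alpha_0-1-2/\log 2$, $u_i:=\alpha-i$ for $2\le i\le5$, and $d_u:=2^{\binom u2}u!$. For real $k>0$ let $L_{S_4}(n,k)$ be the maximum of $$n\log n-n+k-\sum_{i=2}^5x_i\log(x_id_{u_i})\qquad(0\log0=0)$$ over real $x_2,\dots,x_5\ge0$ with $\sum_ix_i=k$ and $\sum_iu_ix_i=n$ ($k$ is called feasible if such $x$ exist). There is a fixed constant $A_*>0$ such that for all sufficiently large $n$ the equation $L_{S_4}(n,k)+(\log 2)k=0$ has exactly one feasible zero $k$ with $|n/k-s_0|\le A_*\log\log n/\log n$; this zero is $r_4^{\mathrm{co}}$. Put $k_{\mathrm{co}}:=\lceil r_4^{\mathrm{co}}\rceil+16$ and let $(k_{\mathrm{co}}p_i^{(n)})_{2\le i\le5}$ be the maximizer in the definition of $L_{S_4}(n,k_{\mathrm{co}})$. Choose integers $\widetilde k_i$ with $|\widetilde k_i-k_{\mathrm{co}}p_i^{(n)}|\le1$, put $e_0:=\sum_i\widetilde k_i-k_{\mathrm{co}}$ and $e_1:=\sum_ii\widetilde k_i-(\alpha k_{\mathrm{co}}-n)$, and set $$k_2:=\widetilde k_2+e_1-3e_0,\quad k_3:=\widetilde k_3+2e_0-e_1,\quad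 k_4:=\widetilde k_4,\quad k_5:=\widetilde k_5.$$ The vector $\mathbf k=(k_2,k_3,k_4,k_5)$ is the exact signed witness profile; $k_i$ is the number of classes of size $u_i$. For sufficiently large $n$ it consists of positive integers with $\sum_ik_i=k_{\mathrm{co}}$, $\sum_iu_ik_i=n$, and $k_i=\Theta(n/\log n)$, and every class size $u_i$ is at least two. **The count.** $Z^{\mathrm{sgn}}_{\mathbf k}$ is the number of pairs consisting of an (unordered) partition of $[n]$ with exactly $k_i$ classes of size $u_i$ for $2\le i\le5$ and a declaration of each class as "independent" or "complete", such that every class induces in $G_n$ an edgeless, respectively complete, graph according to its declaration. **Overlaps.** Label the slots within each of the four types: row slots $a\in\mathcal I_{\mathrm{row}}$ and column slots $b\in\mathcal I_{\mathrm{col}}$, each side having $k_i$ slots of size $u_i$. Let $(V_a)_a$ and $(W_b)_b$ be two independent uniform ordered partitions of $[n]$ with this profile, with $s_a:=|V_a|$, $t_b:=|W_b|$, $\mathbf s=(s_a)$, $\mathbf t=(t_b)$. Their overlap matrix is $r_{ab}=|V_a\cap W_b|$. $\mathcal R(\mathbf s,\mathbf t)$ is the finite set of nonnegative integer matrices with row sums $\mathbf s$ and column sums $\mathbf t$, and $p(r)$ is the exact law of the overlap matrix. **Normalized local factor.** For a pair of ordered partitions with overlap matrix $r$, $A_\zeta(r)$ is the sum, over all pairs of declaration assignments (one to the row classes, one to the column classes), of the probability that $G_n$ realizes all declarations of both partitions, divided by $(2^{k_{\mathrm{co}}}2^{-B})^2$, where $B=\sum_a\binom{s_a}2$. **Support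 graph.** $H(r)$ is the simple bipartite graph whose edges are the cells $(a,b)$ with $r_{ab}\ge2$ and whose vertices are the slots incident to such an edge; $c(H)$ is its number of connected components, with $c(\varnothing)=0$, and $\beta(H):=|E(H)|-|V(H)|+c(H)$. *)

theory Defs
  imports "HOL-Probability.Probability"
begin

section \<open>The random graph\<close>

definition vertex_pairs :: "nat \<Rightarrow> nat set set" where
  "vertex_pairs n = {e. e \<subseteq> {1..n} \<and> card e = 2}"

text \<open>A graph on \<open>{1..n}\<close> is the indicator function of its edge set, \<open>False\<close> outside
  \<open>vertex_pairs n\<close>.\<close>

definition random_graph :: "nat \<Rightarrow> (nat set \<Rightarrow> bool) pmf" where
  "random_graph n = Pi_pmf (vertex_pairs n) False (\<lambda>_. bernoulli_pmf (1/2))"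

datatype class_decl = Independent | Complete

fun realizes :: "(nat set \<Rightarrow> bool) \<Rightarrow> class_decl \<Rightarrow> nat set \<Rightarrow> bool" where
  "realizes G Independent C \<longleftrightarrow> (\<forall>e. e \<subseteq> C \<and> card e = 2 \<longrightarrow> \<not> G e)"
| "realizes G Complete C \<longleftrightarrow> (\<forall>e. e \<subseteq> C \<and> card e = 2 \<longrightarrow> G e)"


section \<open>The exact signed witness profile\<close>

definition alpha0 :: "nat \<Rightarrow> real" where
  "alpha0 n = 2 * log 2 (real n) - 2 * log 2 (log 2 (real n)) + 2 * log 2 (exp 1 / 2) + 1"

definition alpha :: "nat \<Rightarrow> int" where
  "alpha n = \<lfloor>alpha0 n\<rfloor>"

definition s0 :: "nat \<Rightarrow> real" where
  "s0 n = alpha0 n - 1 - 2 / ln 2"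

text \<open>The truncation at 0 only matters for the finitely many \<open>n\<close> with \<open>alpha n < 5\<close>.\<close>

definition class_size :: "nat \<Rightarrow> nat \<Rightarrow> nat" where
  "class_size n i = nat (alpha n - int i)"

definition d_weight :: "nat \<Rightarrow> real" where
  "d_weight u = 2 ^ (u choose 2) * fact u"

text \<open>Only the values of \<open>x\<close> on \<open>{2..5}\<close> are relevant.\<close>

definition feasible_points :: "nat \<Rightarrow> real \<Rightarrow> (nat \<Rightarrow> real) set" where
  "feasible_points n k =
     {x. (\<forall>i\<in>{2..5}. 0 \<le> x i) \<and> (\<Sum>i=2..5. x i) = k
       \<and> (\<Sum>i=2..5. real (class_size n i) * x i) = real n}"

text \<open>Since \<open>ln 0 = 0\<close>, the convention \<open>0 log 0 = 0\<close> holds.\<close>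

definition L_objective :: "nat \<Rightarrow> real \<Rightarrow> (nat \<Rightarrow> real) \<Rightarrow> real" where
  "L_objective n k x = real n * ln (real n) - real n + k
     - (\<Sum>i=2..5. x i * ln (x i * d_weight (class_size n i)))"

text \<open>For feasible \<open>k\<close> the supremum is a maximum, by compactness and continuity.\<close>

definition L_S4 :: "nat \<Rightarrow> real \<Rightarrow> real" where
  "L_S4 n k = (SUP x\<in>feasible_points n k. L_objective n k x)"

definition is_L_maximizer :: "nat \<Rightarrow> real \<Rightarrow> (nat \<Rightarrow> real) \<Rightarrow> bool" where
  "is_L_maximizer n k x \<longleftrightarrow> x \<in> feasible_points n k
     \<and> (\<forall>y\<in>feasible_points n k. L_objective n k y \<le> L_objective n k x)"

definition is_window_zero :: "real \<Rightarrow> nat \<Rightarrow> real \<Rightarrow> bool" where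
  "is_window_zero A n k \<longleftrightarrow> 0 < k \<and> feasible_points n k \<noteq> {}
     \<and> L_S4 n k + ln 2 * k = 0
     \<and> \<bar>real n / k - s0 n\<bar> \<le> A * ln (ln (real n)) / ln (real n)"

definition r4co :: "real \<Rightarrow> nat \<Rightarrow> real" where
  "r4co A n = (THE k. is_window_zero A n k)"

definition k_co :: "real \<Rightarrow> nat \<Rightarrow> int" where
  "k_co A n = \<lceil>r4co A n\<rceil> + 16"

text \<open>The rounded vector \<open>kt\<close> is a choice, so this is a predicate: it holds for the profile
  produced by any admissible choice. Only the values of \<open>k\<close> on \<open>{2..5}\<close> are relevant.\<close>

definition exact_signed_witness_profile :: "real \<Rightarrow> nat \<Rightarrow> (nat \<Rightarrow> int) \<Rightarrow> bool" where
  "exact_signed_witness_profile A n k \<longleftrightarrow>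
     (\<exists>(p :: nat \<Rightarrow> real) (kt :: nat \<Rightarrow> int) (e0 :: int) (e1 :: int).
        is_L_maximizer n (of_int (k_co A n)) (\<lambda>i. of_int (k_co A n) * p i)
      \<and> (\<forall>i\<in>{2..5}. \<bar>of_int (kt i) - of_int (k_co A n) * p i\<bar> \<le> 1)
      \<and> e0 = (\<Sum>i=2..5. kt i) - k_co A n
      \<and> e1 = (\<Sum>i=2..5. int i * kt i) - (alpha n * k_co A n - int n)
      \<and> k 2 = kt 2 + e1 - 3 * e0
      \<and> k 3 = kt 3 + 2 * e0 - e1
      \<and> k 4 = kt 4
      \<and> k 5 = kt 5)"


section \<open>The signed witness count\<close>

definition signed_partitions :: "nat \<Rightarrow> (nat \<Rightarrow> int) \<Rightarrow> (nat set set \<times> (nat set \<Rightarrow> class_decl)) set" where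
  "signed_partitions n k =
     {(P, D). partition_on {1..n} P
        \<and> (\<forall>i\<in>{2..5}. int (card {C \<in> P. card C = class_size n i}) = k i)
        \<and> D \<in> P \<rightarrow>\<^sub>E UNIV}"

definition Z_sgn :: "nat \<Rightarrow> (nat \<Rightarrow> int) \<Rightarrow> (nat set \<Rightarrow> bool) \<Rightarrow> nat" where
  "Z_sgn n k G = card {(P, D) \<in> signed_partitions n k. \<forall>C\<in>P. realizes G (D C) C}"


section \<open>Ordered partitions and overlaps\<close>

text \<open>The slot \<open>(i, j)\<close> is the \<open>j\<close>-th slot of type \<open>i\<close>. Rows and columns have the same profile,
  so the set of slots serves as index set for both sides.\<close>

definition slots :: "(nat \<Rightarrow> int) \<Rightarrow> (nat \<times> nat) set" where
  "slots k = (SIGMA i:{2..5}. {..<nat (k i)})"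

definition slot_size :: "nat \<Rightarrow> nat \<times> nat \<Rightarrow> nat" where
  "slot_size n a = class_size n (fst a)"

definition ordered_partitions :: "nat \<Rightarrow> 'a set \<Rightarrow> ('a \<Rightarrow> nat) \<Rightarrow> ('a \<Rightarrow> nat set) set" where
  "ordered_partitions n I s =
     {V. (\<forall>a. a \<notin> I \<longrightarrow> V a = {}) \<and> (\<forall>a\<in>I. card (V a) = s a)
       \<and> disjoint_family_on V I \<and> (\<Union>a\<in>I. V a) = {1..n}}"

definition overlap :: "('a \<Rightarrow> nat set) \<Rightarrow> ('b \<Rightarrow> nat set) \<Rightarrow> 'a \<Rightarrow> 'b \<Rightarrow> nat" where
  "overlap V W a b = card (V a \<inter> W b)"

definition overlap_matrices ::
  "'a set \<Rightarrow> 'b set \<Rightarrow> ('a \<Rightarrow> nat) \<Rightarrow> ('b \<Rightarrow> nat) \<Rightarrow> ('a \<Rightarrow> 'b \<Rightarrow> nat) set" where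
  "overlap_matrices I J s t =
     {r. (\<forall>a b. a \<notin> I \<or> b \<notin> J \<longrightarrow> r a b = 0)
       \<and> (\<forall>a\<in>I. (\<Sum>b\<in>J. r a b) = s a) \<and> (\<forall>b\<in>J. (\<Sum>a\<in>I. r a b) = t b)}"

definition overlap_law ::
  "nat \<Rightarrow> 'a set \<Rightarrow> 'b set \<Rightarrow> ('a \<Rightarrow> nat) \<Rightarrow> ('b \<Rightarrow> nat) \<Rightarrow> ('a \<Rightarrow> 'b \<Rightarrow> nat) pmf" where
  "overlap_law n I J s t =
     map_pmf (\<lambda>(V, W). overlap V W)
       (pair_pmf (pmf_of_set (ordered_partitions n I s)) (pmf_of_set (ordered_partitions n J t)))"

text \<open>The normalized local factor of a pair of ordered partitions, with \<open>K\<close> classes on each side.\<close>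

definition pair_local_factor ::
  "nat \<Rightarrow> int \<Rightarrow> 'a set \<Rightarrow> 'b set \<Rightarrow> ('a \<Rightarrow> nat set) \<Rightarrow> ('b \<Rightarrow> nat set) \<Rightarrow> real" where
  "pair_local_factor n K I J V W =
     (\<Sum>\<sigma> \<in> I \<rightarrow>\<^sub>E UNIV. \<Sum>\<tau> \<in> J \<rightarrow>\<^sub>E UNIV.
        measure_pmf.prob (random_graph n)
          {G. (\<forall>a\<in>I. realizes G (\<sigma> a) (V a)) \<and> (\<forall>b\<in>J. realizes G (\<tau> b) (W b))})
     / (2 powi K * 2 powi (- int (\<Sum>a\<in>I. card (V a) choose 2)))\<^sup>2"

text \<open>As a function of the overlap matrix: the factor of some pair with that overlap matrix.
  Independence of the chosen pair is not built in; it has to be proved.\<close>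

definition A_zeta ::
  "nat \<Rightarrow> int \<Rightarrow> 'a set \<Rightarrow> 'b set \<Rightarrow> ('a \<Rightarrow> nat) \<Rightarrow> ('b \<Rightarrow> nat) \<Rightarrow> ('a \<Rightarrow> 'b \<Rightarrow> nat) \<Rightarrow> real" where
  "A_zeta n K I J s t r =
     (case (SOME (V, W). V \<in> ordered_partitions n I s \<and> W \<in> ordered_partitions n J t
              \<and> overlap V W = r)
      of (V, W) \<Rightarrow> pair_local_factor n K I J V W)"


section \<open>The support graph\<close>

text \<open>Row slots are tagged by \<open>Inl\<close>, column slots by \<open>Inr\<close>; an edge is a cell \<open>(a, b)\<close>.\<close>

definition H_edges :: "('a \<Rightarrow> 'b \<Rightarrow> nat) \<Rightarrow> ('a \<times> 'b) set" where
  "H_edges r = {(a, b). 2 \<le> r a b}"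

definition H_vertices :: "('a \<Rightarrow> 'b \<Rightarrow> nat) \<Rightarrow> ('a + 'b) set" where
  "H_vertices r = (\<Union>(a, b)\<in>H_edges r. {Inl a, Inr b})"

definition H_adjacency :: "('a \<Rightarrow> 'b \<Rightarrow> nat) \<Rightarrow> (('a + 'b) \<times> ('a + 'b)) set" where
  "H_adjacency r = (\<Union>(a, b)\<in>H_edges r. {(Inl a, Inr b), (Inr b, Inl a)})"

definition H_components :: "('a \<Rightarrow> 'b \<Rightarrow> nat) \<Rightarrow> ('a + 'b) set set" where
  "H_components r = H_vertices r // (H_adjacency r)\<^sup>*"

definition H_beta :: "('a \<Rightarrow> 'b \<Rightarrow> nat) \<Rightarrow> int" where
  "H_beta r = int (card (H_edges r)) - int (card (H_vertices r)) + int (card (H_components r))"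

definition overlap_weight :: "'a set \<Rightarrow> 'b set \<Rightarrow> ('a \<Rightarrow> 'b \<Rightarrow> nat) \<Rightarrow> nat" where
  "overlap_weight I J r = (\<Sum>a\<in>I. \<Sum>b\<in>J. r a b choose 2)"

definition g_weight :: "nat \<Rightarrow> real" where
  "g_weight x = (if x \<le> 2 then 1 else 2 ^ ((x choose 2) - 1))"

end

theory Submission
  imports Defs "HOL-Real_Asymp.Real_Asymp"
begin

text \<open>
  Two sets of declarations can be realized together iff they agree on every cell of size at least
  two, that is, iff they are constant on the components of \<open>H\<close>; this leaves
  \<open>2 ^ (|I| + |J| - |V(H)| + c(H))\<close> choices. Each of them prescribes \<open>2B - W\<close> pairs, since a pair
  prescribed by both sides lies in a single cell. A pair of ordered partitions with overlap matrix
  \<open>r\<close> is an ordered partition into cells, so it is counted by a multinomial coefficient. Ordering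
  the classes multiplies the signed count by the constant number of size-preserving permutations
  of the slots, which cancels in the second moment ratio.

  All of this needs the profile to be nonnegative. Perturbing the maximizer of \<open>L\<close> along integer
  vectors that preserve \<open>\<Sum>x\<^sub>i\<close> and \<open>\<Sum>i x\<^sub>i\<close> compares neighbouring products \<open>x\<^sub>i x\<^sub>j\<close> up to a factor 4,
  and the mean type \<open>\<alpha> - n/k\<close> lies well inside \<open>[2, 5]\<close>; hence every \<open>x\<^sub>i\<close> is at least a fixed
  fraction of \<open>k\<close>, which outweighs the bounded rounding corrections.
\<close>

section \<open>The maximizing profile\<close>

text \<open>Finite perturbations followed by exponentiation give inequalities between products,
  which survive the limit at the boundary; positivity of all coordinates then comes out as a
  conclusion. Negative entries have to be excluded because \<open>slots\<close> truncates them by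
  \<open>nat\<close>, so that slots and profile would no longer describe the same partitions. Two
  further points hide in the definitions. \<open>A_zeta\<close> selects a pair by choice, so each
  matrix must be shown to come from some pair; this follows because the multinomial count is not
  zero. And \<open>signed_partitions\<close> prescribes only the numbers of classes of four sizes;
  that no other classes occur follows from the total size being \<open>n\<close>.\<close>

text \<open>Convexity of \<open>x ln (x d)\<close>, with the tangent taken at \<open>y\<close> so that \<open>x = 0\<close> is allowed.\<close>

lemma xlnx_diff_le:
  fixes x y d :: real
  assumes "0 \<le> x" "0 < y" "0 < d"
  shows "y * ln (y * d) - x * ln (x * d) \<le> (y - x) * (ln (y * d) + 1)"
proof (cases "x = 0")
  case False
  then have x: "x > 0" using assms by simp
  have "ln (y * d) - ln (x * d) = ln (y / x)"
    using x assms by (simp add: ln_mult ln_div)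
  also have "\<dots> \<le> y / x - 1" using x assms by (intro ln_le_minus_one) auto
  finally have "x * (ln (y * d) - ln (x * d)) \<le> x * (y / x - 1)"
    using x by (intro mult_left_mono) auto
  also have "\<dots> = y - x" using x by (simp add: field_simps)
  finally show ?thesis by (simp add: algebra_simps)
qed (use assms in \<open>auto simp: algebra_simps\<close>)

text \<open>Compares the maximum with the value after a step of length \<open>t\<close>. The
  tangents are taken at the new point, whose moved coordinates are positive, so a zero coordinate of
  \<open>x\<close> does no harm; the constant parts of the slopes cancel because \<open>v\<close>
  sums to zero.\<close>

lemma optimal_direction:
  assumes opt: "is_L_maximizer n k x"
    and t: "0 < t"
    and v: "(\<Sum>i=2..5. v i) = 0" "(\<Sum>i=2..5. real (class_size n i) * v i) = 0"
    and pos: "\<And>i. i \<in> {2..5} \<Longrightarrow> v i \<noteq> 0 \<Longrightarrow> 0 < x i + t * v i"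
  shows "0 \<le> (\<Sum>i=2..5. v i * ln ((x i + t * v i) * d_weight (class_size n i)))"
proof -
  let ?y = "\<lambda>i. x i + t * v i"
  let ?d = "\<lambda>i. d_weight (class_size n i)"
  have x: "x \<in> feasible_points n k"
    using opt by (simp add: is_L_maximizer_def)
  have "?y \<in> feasible_points n k"
    unfolding feasible_points_def mem_Collect_eq
  proof (intro conjI ballI)
    fix i :: nat assume "i \<in> {2..5}"
    then show "0 \<le> ?y i"
      using pos[of i] x by (cases "v i = 0") (auto simp: feasible_points_def)
  next
    show "(\<Sum>i=2..5. ?y i) = k"
      using x v(1) by (simp add: feasible_points_def sum.distrib flip: sum_distrib_left)
  next
    have "(\<Sum>i=2..5. real (class_size n i) * ?y i) = (\<Sum>i=2..5. real (class_size n i) * x i)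
        + t * (\<Sum>i=2..5. real (class_size n i) * v i)"
      by (simp add: sum_distrib_left sum.distrib algebra_simps)
    then show "(\<Sum>i=2..5. real (class_size n i) * ?y i) = real n"
      using x v(2) by (simp add: feasible_points_def)
  qed
  then have "L_objective n k ?y \<le> L_objective n k x"
    using opt by (simp add: is_L_maximizer_def)
  then have "0 \<le> (\<Sum>i=2..5. ?y i * ln (?y i * ?d i) - x i * ln (x i * ?d i))"
    by (simp add: L_objective_def sum_subtractf)
  also have "\<dots> \<le> (\<Sum>i=2..5. t * v i * (ln (?y i * ?d i) + 1))"
  proof (rule sum_mono)
    fix i :: nat assume i: "i \<in> {2..5}"
    show "?y i * ln (?y i * ?d i) - x i * ln (x i * ?d i) \<le> t * v i * (ln (?y i * ?d i) + 1)"
    proof (cases "v i = 0")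
      case False
      then show ?thesis
        using xlnx_diff_le[of "x i" "?y i" "?d i"] pos[OF i] x i
        by (auto simp: feasible_points_def d_weight_def)
    qed auto
  qed
  also have "\<dots> = t * (\<Sum>i=2..5. v i * ln (?y i * ?d i)) + t * (\<Sum>i=2..5. v i)"
    by (simp add: sum_distrib_left sum.distrib algebra_simps)
  finally show ?thesis
    using t v(1) by (simp add: zero_le_mult_iff)
qed

lemma sum_2_5: "(\<Sum>i=2..5. f i) = f 2 + f 3 + f 4 + f (5::nat)"
  for f :: "nat \<Rightarrow> 'a::comm_monoid_add"
  by (simp add: numeral_eq_Suc atLeastAtMostSuc_conv ac_simps)

lemma limit_at_right_le:
  fixes f g :: "real \<Rightarrow> real"
  assumes "continuous_on UNIV f" "continuous_on UNIV g" "0 < e"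
    and "\<And>t. 0 < t \<Longrightarrow> t < e \<Longrightarrow> f t \<le> g t"
  shows "f 0 \<le> g 0"
proof (rule tendsto_le[where F = "at_right 0"])
  show "(g \<longlongrightarrow> g 0) (at_right 0)" "(f \<longlongrightarrow> f 0) (at_right 0)"
    using assms(1,2) unfolding continuous_on_def
    by (auto intro: filterlim_mono[OF _ order_refl at_le])
  show "\<forall>\<^sub>F t in at_right 0. f t \<le> g t"
    using assms(3,4) by (auto simp: eventually_at_right_field)
qed simp

lemma class_size_linear:
  assumes "5 \<le> alpha n" "i \<in> {2..5}"
  shows "real (class_size n i) = of_int (alpha n) - real i"
  using assms by (auto simp: class_size_def)

lemma sum_mult_ln:
  fixes f :: "'a \<Rightarrow> real"
  assumes "\<And>i. i \<in> S \<Longrightarrow> 0 < f i"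
  shows "(\<Sum>i\<in>S. real (m i) * ln (f i)) = ln (\<Prod>i\<in>S. f i ^ m i)"
proof -
  have "(\<Sum>i\<in>S. real (m i) * ln (f i)) = (\<Sum>i\<in>S. ln (f i ^ m i))"
    using assms by (intro sum.cong refl) (simp add: ln_realpow)
  also have "\<dots> = ln (\<Prod>i\<in>S. f i ^ m i)"
  proof (cases "finite S")
    case True
    have "f i ^ m i \<noteq> 0" if "i \<in> S" for i
      using assms[OF that] by simp
    then show ?thesis using ln_prod[OF True, of "\<lambda>i. f i ^ m i"] by simp
  qed simp
  finally show ?thesis .
qed

text \<open>The first-order condition in direction \<open>v\<close>, in product form so that vanishing \<open>x i\<close> are covered.\<close>

lemma maximizer_inequality:
  assumes opt: "is_L_maximizer n k x" and al: "5 \<le> alpha n"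
    and v: "(\<Sum>i=2..5. v i) = (0::int)" "(\<Sum>i=2..5. int i * v i) = 0"
  shows "(\<Prod>i | i \<in> {2..5} \<and> v i < 0. (x i * d_weight (class_size n i)) ^ nat (- v i))
    \<le> (\<Prod>i | i \<in> {2..5} \<and> 0 < v i. (x i * d_weight (class_size n i)) ^ nat (v i))"
    (is "(\<Prod>i\<in>?M. ?z i ^ _) \<le> (\<Prod>i\<in>?P. ?z i ^ _)")
proof -
  let ?d = "\<lambda>i. d_weight (class_size n i)"
  let ?y = "\<lambda>t i. (x i + t * of_int (v i)) * ?d i"
  have x: "\<And>i. i \<in> {2..5} \<Longrightarrow> 0 \<le> x i"
    using opt by (auto simp: is_L_maximizer_def feasible_points_def)
  have d: "0 < ?d i" for i by (simp add: d_weight_def)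
  have P0: "0 \<le> (\<Prod>i\<in>?P. ?z i ^ nat (v i))"
    by (intro prod_nonneg ballI zero_le_power mult_nonneg_nonneg)
       (use x d in \<open>auto intro: less_imp_le\<close>)
  show ?thesis
  proof (cases "\<exists>i\<in>?M. x i = 0")
    case True
    then obtain i where i: "i \<in> ?M" "x i = 0" by blast
    have "(\<Prod>i\<in>?M. ?z i ^ nat (- v i)) = 0"
      using i by (intro prod_zero bexI[of _ i]) auto
    show ?thesis using P0 unfolding \<open>(\<Prod>i\<in>?M. _) = 0\<close> .
  next
    case False
    then have xM: "0 < x i" if "i \<in> ?M" for i
      using x that by (metis (no_types, lifting) mem_Collect_eq order_le_less)
    \<comment> \<open>A step shorter than \<open>e\<close> keeps every decreasing coordinate
      positive. The 1 covers the case of no decreasing coordinate, where the minimum would be over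
      the empty set.\<close>
    define e where "e = Min (insert 1 ((\<lambda>i. x i / of_int (- v i)) ` ?M))"
    have fin: "finite ?M" by simp
    have e: "0 < e"
      unfolding e_def using xM by (subst Min_gr_iff) (auto simp: divide_pos_neg intro!: divide_pos_pos)
    have ineq: "(\<Prod>i\<in>?M. ?y t i ^ nat (- v i)) \<le> (\<Prod>i\<in>?P. ?y t i ^ nat (v i))"
      if t: "0 < t" "t < e" for t
    proof -
      have pos: "0 < x i + t * of_int (v i)" if i: "i \<in> {2..5}" "v i \<noteq> 0" for i
      proof (cases "v i < 0")
        case True
        then have "e \<le> x i / of_int (- v i)"
          unfolding e_def using fin i by (intro Min_le) auto
        then have "t < x i / of_int (- v i)" using t by simp
        then show ?thesis using True by (simp add: field_simps)
      next
        case False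
        then show ?thesis using i x[of i] t by (intro add_nonneg_pos) auto
      qed
      have yp: "0 < ?y t i" if "i \<in> {2..5}" "v i \<noteq> 0" for i
        using pos[OF that] d by simp
      have "0 \<le> (\<Sum>i=2..5. of_int (v i) * ln (?y t i))"
      proof (rule optimal_direction[OF opt t(1)])
        show 1: "(\<Sum>i=2..5. real_of_int (v i)) = 0"
          using v(1) by (simp flip: of_int_sum)
        have "(\<Sum>i=2..5. real i * of_int (v i)) = real_of_int (\<Sum>i=2..5. int i * v i)"
          by simp
        then have 2: "(\<Sum>i=2..5. real i * of_int (v i)) = 0" using v(2) by simp
        \<comment> \<open>Class sizes are affine in \<open>i\<close>, so the size constraint follows
          from the two moment conditions on \<open>v\<close>.\<close>
        have "(\<Sum>i=2..5. real (class_size n i) * of_int (v i))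
            = (\<Sum>i=2..5. of_int (alpha n) * of_int (v i) - real i * of_int (v i))"
          by (intro sum.cong refl) (subst class_size_linear[OF al], assumption, simp add: left_diff_distrib)
        then show "(\<Sum>i=2..5. real (class_size n i) * of_int (v i)) = 0"
          using 1 2 by (simp add: sum_subtractf flip: sum_distrib_left)
      qed (use pos in auto)
      also have "(\<Sum>i=2..5. of_int (v i) * ln (?y t i))
          = (\<Sum>i\<in>?P \<union> ?M. of_int (v i) * ln (?y t i))"
        by (rule sum.mono_neutral_right) (auto simp: not_less)
      also have "\<dots> = (\<Sum>i\<in>?P. of_int (v i) * ln (?y t i)) + (\<Sum>i\<in>?M. of_int (v i) * ln (?y t i))"
        by (rule sum.union_disjoint) auto
      also have "(\<Sum>i\<in>?P. of_int (v i) * ln (?y t i)) = (\<Sum>i\<in>?P. real (nat (v i)) * ln (?y t i))"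
        by (intro sum.cong refl) auto
      also have "\<dots> = ln (\<Prod>i\<in>?P. ?y t i ^ nat (v i))"
        by (intro sum_mult_ln yp) auto
      also have "(\<Sum>i\<in>?M. of_int (v i) * ln (?y t i)) = - (\<Sum>i\<in>?M. real (nat (- v i)) * ln (?y t i))"
        unfolding sum_negf[symmetric] by (intro sum.cong refl) auto
      also have "(\<Sum>i\<in>?M. real (nat (- v i)) * ln (?y t i)) = ln (\<Prod>i\<in>?M. ?y t i ^ nat (- v i))"
        by (intro sum_mult_ln yp) auto
      finally have "ln (\<Prod>i\<in>?M. ?y t i ^ nat (- v i)) \<le> ln (\<Prod>i\<in>?P. ?y t i ^ nat (v i))"
        by simp
      moreover have "0 < (\<Prod>i\<in>?M. ?y t i ^ nat (- v i))" "0 < (\<Prod>i\<in>?P. ?y t i ^ nat (v i))"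
        by (intro prod_pos ballI zero_less_power yp; simp)+
      ultimately show ?thesis by (subst (asm) ln_le_cancel_iff)
    qed
    \<comment> \<open>The products are polynomials in \<open>t\<close>, hence continuous at 0 even
      where the logarithms are not.\<close>
    have "(\<Prod>i\<in>?M. ?y 0 i ^ nat (- v i)) \<le> (\<Prod>i\<in>?P. ?y 0 i ^ nat (v i))"
      by (rule limit_at_right_le[OF _ _ e ineq]) (intro continuous_intros)+
    then show ?thesis by simp
  qed
qed

section \<open>Log-convexity of the weights and its effect on the maximizer\<close>

lemma d_weight_Suc: "d_weight (Suc u) = 2 ^ u * real (Suc u) * d_weight u"
  by (simp add: d_weight_def numeral_2_eq_2 power_add)

lemma d_weight_pos: "0 < d_weight u"
  by (simp add: d_weight_def)

text \<open>The second difference of \<open>u choose 2\<close> is 1, and the factorials contribute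
  \<open>(u + 1) / u\<close>. The resulting factor lies between 2 and 4; this is the origin of the 4
  in the comparison of products.\<close>

lemma d_weight_second_difference:
  assumes "0 < u"
  shows "d_weight (u - 1) * d_weight (u + 1) = 2 * (real u + 1) / real u * (d_weight u)\<^sup>2"
proof -
  obtain w where w: "u = Suc w" using assms not0_implies_Suc by blast
  have "d_weight w * d_weight (Suc (Suc w)) = 2 * (real w + 2) / (real w + 1) * (d_weight (Suc w))\<^sup>2"
    unfolding d_weight_Suc[of "Suc w"] unfolding d_weight_Suc[of w]
    by (simp add: field_simps power2_eq_square)
  then show ?thesis by (simp add: w ac_simps)
qed

text \<open>The quotient of consecutive weights, \<open>2 ^ u * (u + 1)\<close>, increases with
  \<open>u\<close>, so the outer product wins.\<close>

lemma d_weight_inner_outer: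
  "d_weight (u + 1) * d_weight (u + 2) \<le> d_weight u * d_weight (u + 3)"
proof -
  have "2 ^ u * real (u + 1) * (d_weight u * d_weight (u + 2))
      \<le> 2 ^ (u + 2) * real (u + 3) * (d_weight u * d_weight (u + 2))"
    by (intro mult_right_mono mult_mono power_increasing)
       (auto intro!: mult_nonneg_nonneg less_imp_le[OF d_weight_pos])
  moreover have "d_weight (u + 1) = 2 ^ u * real (u + 1) * d_weight u"
    using d_weight_Suc[of u] by simp
  moreover have "d_weight (u + 3) = 2 ^ (u + 2) * real (u + 3) * d_weight (u + 2)"
    using d_weight_Suc[of "u + 2"] by (simp add: numeral_3_eq_3)
  ultimately show ?thesis by (simp only: ac_simps)
qed

text \<open>The directions (1,-2,1,0), its negative, (0,1,-2,1) and (-1,1,1,-1) on the types 2 to 5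
  preserve both constraints. At an interior maximizer \<open>x i * d_weight (class_size n i)\<close>
  would be geometric in \<open>i\<close>; these inequalities keep enough of that on the boundary
  too.\<close>

lemma maximizer_relations:
  assumes opt: "is_L_maximizer n k x" and al: "6 \<le> alpha n"
  shows "x 3 ^ 2 \<le> 4 * x 2 * x 4" "x 2 * x 4 \<le> x 3 ^ 2" "x 4 ^ 2 \<le> 4 * x 3 * x 5"
    "x 2 * x 5 \<le> x 3 * x 4"
proof -
  define u where "u = class_size n 5"
  let ?d = "\<lambda>i. d_weight (class_size n i)"
  have u: "class_size n 4 = u + 1" "class_size n 3 = u + 2" "class_size n 2 = u + 3" "0 < u"
    using al by (auto simp: u_def class_size_def)
  have d: "0 < ?d i" for i by (rule d_weight_pos)
  have al5: "5 \<le> alpha n" using al by simp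
  have x: "0 \<le> x 2" "0 \<le> x 3" "0 \<le> x 4" "0 \<le> x 5"
    using opt by (auto simp: is_L_maximizer_def feasible_points_def)
  have sets: "{i. (2::nat) \<le> i \<and> i \<le> 5 \<and> P i} = {i \<in> {2,3,4,5}. P i}" for P
    by auto
  note ineq = maximizer_inequality[OF opt al5]
  have eq1: "?d 2 * ?d 4 = 2 * (real (u + 2) + 1) / real (u + 2) * (?d 3)\<^sup>2"
    using d_weight_second_difference[of "u + 2"] unfolding u by (simp add: numeral_eq_Suc ac_simps)
  have eq2: "?d 3 * ?d 5 = 2 * (real (u + 1) + 1) / real (u + 1) * (?d 4)\<^sup>2"
    using d_weight_second_difference[of "u + 1"] unfolding u by (simp add: u_def numeral_eq_Suc ac_simps)
  have in3: "?d 3 * ?d 4 \<le> ?d 2 * ?d 5"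
    using d_weight_inner_outer[of u] unfolding u by (simp add: u_def ac_simps)
  have ratio: "(1::real) \<le> 2 * (real w + 1) / real w" "2 * (real w + 1) / real w \<le> 4" if "0 < w" for w
    using that by (auto simp: field_simps)
  have cancel_le: "p \<le> r * q" if "p * a \<le> q * b" "b = c * a" "0 < a" "c \<le> r" "0 \<le> q" for a b c p q r :: real
  proof -
    have "p * a \<le> (c * q) * a" using that by (simp add: ac_simps)
    then have "p \<le> c * q" using that by simp
    also have "\<dots> \<le> r * q" using that by (intro mult_right_mono) auto
    finally show ?thesis .
  qed
  have cancel_ge: "q \<le> p" if "q * b \<le> p * a" "b = c * a" "0 < a" "1 \<le> c" "0 \<le> q" for a b c p q :: real
  proof -
    have "(c * q) * a \<le> p * a" using that by (simp add: ac_simps)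
    then have "c * q \<le> p" using that by simp
    moreover have "1 * q \<le> c * q" using that by (intro mult_right_mono) auto
    ultimately show ?thesis by simp
  qed
  have i1: "x 3 ^ 2 * (?d 3)\<^sup>2 \<le> (x 2 * x 4) * (?d 2 * ?d 4)"
    using ineq[of "\<lambda>i. if i = 2 then 1 else if i = 3 then -2 else if i = 4 then 1 else 0"]
    by (simp add: sum_2_5 sets Collect_conv_if conj_disj_distribR Collect_disj_eq power_mult_distrib ac_simps)
  show "x 3 ^ 2 \<le> 4 * x 2 * x 4"
    using cancel_le[OF i1 eq1] d[of 3] ratio(2)[of "u + 2"] x by (simp add: ac_simps)
  have i2: "(x 2 * x 4) * (?d 2 * ?d 4) \<le> x 3 ^ 2 * (?d 3)\<^sup>2"
    using ineq[of "\<lambda>i. if i = 2 then -1 else if i = 3 then 2 else if i = 4 then -1 else 0"]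
    by (simp add: sum_2_5 sets Collect_conv_if conj_disj_distribR Collect_disj_eq power_mult_distrib ac_simps)
  show "x 2 * x 4 \<le> x 3 ^ 2"
    using cancel_ge[OF i2 eq1] d[of 3] ratio(1)[of "u + 2"] x by (simp add: ac_simps)
  have i3: "x 4 ^ 2 * (?d 4)\<^sup>2 \<le> (x 3 * x 5) * (?d 3 * ?d 5)"
    using ineq[of "\<lambda>i. if i = 3 then 1 else if i = 4 then -2 else if i = 5 then 1 else 0"]
    by (simp add: sum_2_5 sets Collect_conv_if conj_disj_distribR Collect_disj_eq power_mult_distrib ac_simps)
  show "x 4 ^ 2 \<le> 4 * x 3 * x 5"
    using cancel_le[OF i3 eq2] d[of 4] ratio(2)[of "u + 1"] x by (simp add: ac_simps)
  have "(x 2 * x 5) * (?d 2 * ?d 5) \<le> (x 3 * x 4) * (?d 3 * ?d 4)"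
    using ineq[of "\<lambda>i. if i = 2 then -1 else if i = 3 then 1 else if i = 4 then 1 else if i = 5 then -1 else 0"]
    by (simp add: sum_2_5 sets Collect_conv_if conj_disj_distribR Collect_disj_eq power_mult_distrib ac_simps)
  also have "\<dots> \<le> (x 3 * x 4) * (?d 2 * ?d 5)"
    using in3 x by (intro mult_left_mono) auto
  finally show "x 2 * x 5 \<le> x 3 * x 4"
    using d[of 2] d[of 5] by simp
qed

text \<open>If \<open>p 3\<close> were tiny, the upper bound on the mean would force a sizable
  \<open>p 2\<close>, and then \<open>p 4\<close> and \<open>p 5\<close> would be at most fixed
  multiples of \<open>p 3\<close>, leaving the mean near 2. The lower bound on \<open>p 3\<close>
  passes to \<open>p 2\<close> and \<open>p 4\<close>, and from \<open>p 4\<close> to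
  \<open>p 5\<close>, each time through a squared relation, which accounts for the small final
  constant.\<close>

lemma profile_weights_bounded_below:
  fixes p :: "nat \<Rightarrow> real"
  assumes nonneg: "0 \<le> p 2" "0 \<le> p 3" "0 \<le> p 4" "0 \<le> p 5"
    and sum: "p 2 + p 3 + p 4 + p 5 = 1"
    and mean: "28/10 \<le> 2 * p 2 + 3 * p 3 + 4 * p 4 + 5 * p 5"
      "2 * p 2 + 3 * p 3 + 4 * p 4 + 5 * p 5 \<le> 395/100"
    and rel: "p 3 ^ 2 \<le> 4 * p 2 * p 4" "p 2 * p 4 \<le> p 3 ^ 2" "p 4 ^ 2 \<le> 4 * p 3 * p 5"
      "p 2 * p 5 \<le> p 3 * p 4"
    and i: "i \<in> {2..5}"
  shows "1 / 10 ^ 14 \<le> p i"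
proof -
  have p3: "1/1000 \<le> p 3"
  proof (rule ccontr)
    assume "\<not> ?thesis"
    then have small: "p 3 < 1/1000" by simp
    \<comment> \<open>Otherwise almost all mass would be on the types 4 and 5, and the mean would
      exceed 3.95.\<close>
    then have p2: "1/50 \<le> p 2" using mean sum nonneg by linarith
    have "1/50 * p 4 \<le> p 2 * p 4" using p2 nonneg by (intro mult_right_mono) auto
    also have "\<dots> \<le> p 3 * (1/1000)"
      using rel(2) small nonneg mult_left_mono[of "p 3" "1/1000" "p 3"] by (simp add: power2_eq_square)
    finally have p4: "p 4 \<le> p 3 / 20" by simp
    have "1/50 * p 5 \<le> p 2 * p 5" using p2 nonneg by (intro mult_right_mono) auto
    also have "\<dots> \<le> p 3 * 1"
      using rel(4) mult_left_mono[of "p 4" 1 "p 3"] nonneg sum by linarith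
    finally have p5: "p 5 \<le> 50 * p 3" by simp
    show False using small p4 p5 mean sum by linarith
  qed
  have sq: "(1/1000)\<^sup>2 \<le> (p 3)\<^sup>2" using p3 by (intro power_mono) auto
  have "p 2 * p 4 \<le> 1 * p 4" "p 2 * p 4 \<le> p 2 * 1"
    using nonneg sum by (intro mult_right_mono mult_left_mono; linarith)+
  then have p4: "1 / 4000000 \<le> p 4" and p2: "1 / 4000000 \<le> p 2"
    using rel(1) sq by (auto simp: power2_eq_square)
  have "(1 / 4000000)\<^sup>2 \<le> (p 4)\<^sup>2" using p4 by (intro power_mono) auto
  moreover have "p 3 * p 5 \<le> 1 * p 5"
    using nonneg sum by (intro mult_right_mono) auto
  ultimately have p5: "1 / 10 ^ 14 \<le> p 5"
    using rel(3) by (simp add: power2_eq_square)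
  have "i = 2 \<or> i = 3 \<or> i = 4 \<or> i = 5" using i by auto
  then show ?thesis using p2 p3 p4 p5 by auto
qed

section \<open>Numerical estimates for large n\<close>

lemma ln_2_ge: "9 / 13 \<le> ln (2::real)"
proof -
  have "exp (9::real) = exp 1 ^ 9" by (simp flip: exp_of_nat_mult)
  \<comment> \<open>The exponents are chosen because 2.72^9, about 8149, is just below 2^13 = 8192.
    The resulting bound \<open>2 / ln 2\<close> \<le> 26/9 is sharp enough to keep the mean type
    below 3.95.\<close>
  also have "\<dots> \<le> (272/100) ^ 9"
    using e_less_272 by (intro power_mono) auto
  also have "\<dots> \<le> 2 ^ 13" by (simp add: power_divide)
  finally have "exp 9 \<le> (2::real) ^ 13" .
  then have "9 \<le> ln ((2::real) ^ 13)" by (subst ln_ge_iff) auto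
  also have "\<dots> = 13 * ln (2::real)" by (subst ln_realpow) auto
  finally show ?thesis by simp
qed

text \<open>The thresholds are the slack of the later estimates: 17 bounds
  \<open>k_co A n - r4co A n\<close>, that is 16 plus the rounding up; each 1/100 is one error term
  in the mean type; 10^16 makes \<open>k\<close> so large that a share of 10^(-14) is at least
  100.\<close>

lemma eventually_scale:
  assumes "0 < A"
  shows "\<forall>\<^sub>F n in sequentially. 8 \<le> alpha0 n \<and> 2 \<le> s0 n \<and> A * ln (ln (real n)) / ln (real n) \<le> 1/100
    \<and> 17 * (s0 n + 1)\<^sup>2 / real n \<le> 1/100 \<and> 10 ^ 16 * (s0 n + 1) \<le> real n"
proof -
  have "\<forall>\<^sub>F n in sequentially. 8 \<le> alpha0 n"
    unfolding alpha0_def by real_asymp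
  moreover have "\<forall>\<^sub>F n in sequentially. 2 \<le> s0 n"
    unfolding s0_def alpha0_def by real_asymp
  moreover have "\<forall>\<^sub>F n in sequentially. A * ln (ln (real n)) / ln (real n) \<le> 1/100"
    using assms by real_asymp
  moreover have "\<forall>\<^sub>F n in sequentially. 17 * (s0 n + 1)\<^sup>2 / real n \<le> 1/100"
    unfolding s0_def alpha0_def by real_asymp
  moreover have "\<forall>\<^sub>F n in sequentially. 10 ^ 16 * (s0 n + 1) \<le> real n"
    unfolding s0_def alpha0_def by real_asymp
  ultimately show ?thesis by eventually_elim blast
qed


lemma sum_weighted_feasible:
  assumes "x \<in> feasible_points n K" "5 \<le> alpha n"
  shows "(\<Sum>i=2..5. real i * x i) = of_int (alpha n) * K - real n"
proof -
  have "(\<Sum>i=2..5. real (class_size n i) * x i) = (\<Sum>i=2..5. of_int (alpha n) * x i - real i * x i)"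
    using assms(2)
    by (intro sum.cong refl) (subst class_size_linear, assumption+, simp add: left_diff_distrib)
  then show ?thesis
    using assms(1) by (auto simp: feasible_points_def sum_subtractf simp flip: sum_distrib_left)
qed

text \<open>The mean type \<open>\<alpha> - n/k\<close> is asymptotically between \<open>2 / ln 2 = 2.885...\<close> and \<open>1 + 2 / ln 2 = 3.885...\<close>.\<close>

lemma mean_type_bounds:
  assumes large: "8 \<le> alpha0 n" "2 \<le> s0 n" "17 * (s0 n + 1)\<^sup>2 / real n \<le> 1/100"
      "10 ^ 16 * (s0 n + 1) \<le> real n"
    and r: "0 < r" "\<bar>real n / r - s0 n\<bar> \<le> 1/100"
    and K: "r \<le> K" "K \<le> r + 17"
  shows "10 ^ 16 \<le> K" "28/10 \<le> of_int (alpha n) - real n / K"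
    "of_int (alpha n) - real n / K \<le> 395/100"
proof -
  have n: "0 < real n" using large by (intro order.strict_trans2[OF _ large(4)]) auto
  have nr: "real n / r \<le> s0 n + 1" using r(2) by linarith
  have "10 ^ 16 * (s0 n + 1) \<le> (s0 n + 1) * r"
    using nr r(1) large(4) by (simp add: field_simps)
  then have "(s0 n + 1) * 10 ^ 16 \<le> (s0 n + 1) * r" by (simp only: ac_simps)
  then have "10 ^ 16 \<le> r" using large(2) by (subst (asm) mult_le_cancel_left_pos) auto
  then show "10 ^ 16 \<le> K" using K(1) by simp
  have K0: "0 < K" using r(1) K(1) by simp
  \<comment> \<open>Passing from \<open>r\<close> to \<open>K\<close> changes \<open>n / r\<close>
    by at most \<open>17 * (n / r)^2 / n\<close>, which is small because \<open>n / r\<close> is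
    only logarithmic in \<open>n\<close>.\<close>
  have "real n / r - real n / K = real n * (K - r) / (r * K)"
    using r(1) K0 by (simp add: field_simps)
  also have "\<dots> \<le> real n * 17 / (r * r)"
    using r(1) K n by (intro frac_le mult_mono) auto
  also have "\<dots> = 17 * (real n / r)\<^sup>2 / real n"
    using n by (simp add: power2_eq_square field_simps)
  also have "\<dots> \<le> 17 * (s0 n + 1)\<^sup>2 / real n"
    using nr r(1) n by (intro divide_right_mono mult_left_mono power_mono) auto
  also note large(3)
  finally have diff: "real n / r - real n / K \<le> 1/100" .
  have mono: "real n / K \<le> real n / r" using r(1) K n by (intro divide_left_mono) auto
  \<comment> \<open>The floor in \<open>alpha\<close> costs anything between 0 and 1, so the mean
    type is confined to an interval of length about 1 and not near a point.\<close>
  have al: "alpha0 n - 1 < of_int (alpha n)" "of_int (alpha n) \<le> alpha0 n"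
    unfolding alpha_def by linarith+
  have "ln (2::real) \<le> 25/36" by (rule ln2_le_25_over_36)
  then have l1: "288/100 \<le> 2 / ln (2::real)" by (simp add: field_simps)
  have l2: "2 / ln (2::real) \<le> 26/9" using ln_2_ge by (simp add: field_simps)
  have s0: "s0 n = alpha0 n - 1 - 2 / ln 2" by (simp add: s0_def)
  show "28/10 \<le> of_int (alpha n) - real n / K"
    using al l1 s0 mono r(2) by linarith
  show "of_int (alpha n) - real n / K \<le> 395/100"
    using al l2 s0 diff r(2) by linarith
qed

text \<open>The interface between the analysis of the profile and the counting. The bound on
  \<open>alpha n\<close> makes the four class sizes distinct and at least 2, and nonnegativity makes
  \<open>nat (k i)\<close> faithful.\<close>

definition valid_profile :: "nat \<Rightarrow> int \<Rightarrow> (nat \<Rightarrow> int) \<Rightarrow> bool" where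
  "valid_profile n K k \<longleftrightarrow> 7 \<le> alpha n \<and> (\<forall>i\<in>{2..5}. 0 \<le> k i) \<and> (\<Sum>i=2..5. k i) = K
     \<and> (\<Sum>i=2..5. int (class_size n i) * k i) = int n"

text \<open>Each coordinate of the maximizer is at least 100, while rounding and the corrections by
  \<open>e0\<close> and \<open>e1\<close> lower it by at most 1 + 14 + 3 * 4 = 27.\<close>

lemma witness_profile_valid:
  assumes A: "A > 0" and ex1: "\<forall>\<^sub>F n in sequentially. \<exists>!k. is_window_zero A n k"
  shows "\<forall>\<^sub>F n in sequentially. \<forall>k. exact_signed_witness_profile A n k \<longrightarrow> valid_profile n (k_co A n) k"
  using ex1 eventually_scale[OF A]
proof eventually_elim
  case (elim n)
  show ?case
  proof (intro allI impI)
    fix k assume "exact_signed_witness_profile A n k"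
    then obtain p kt e0 e1 where
      opt: "is_L_maximizer n (of_int (k_co A n)) (\<lambda>i. of_int (k_co A n) * p i)"
      and kt: "\<And>i. i \<in> {2..5} \<Longrightarrow> \<bar>of_int (kt i) - of_int (k_co A n) * p i\<bar> \<le> (1::real)"
      and e0: "e0 = (\<Sum>i=2..5. kt i) - k_co A n"
      and e1: "e1 = (\<Sum>i=2..5. int i * kt i) - (alpha n * k_co A n - int n)"
      and k: "k 2 = kt 2 + e1 - 3 * e0" "k 3 = kt 3 + 2 * e0 - e1" "k 4 = kt 4" "k 5 = kt 5"
      unfolding exact_signed_witness_profile_def by blast
    define K where "K = k_co A n"
    \<comment> \<open>Existence and uniqueness of the window zero give the definite description in
      \<open>r4co\<close> its meaning.\<close>
    have "is_window_zero A n (r4co A n)"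
      unfolding r4co_def using elim(1) by (rule theI')
    then have r: "0 < r4co A n" "\<bar>real n / r4co A n - s0 n\<bar> \<le> 1/100"
      using elim(2) unfolding is_window_zero_def by (blast intro: order_trans)+
    have K: "r4co A n \<le> of_int K" "of_int K \<le> r4co A n + 17"
      unfolding K_def k_co_def by linarith+
    have "real_of_int 7 \<le> alpha0 n" using elim(2) by simp
    then have al: "7 \<le> alpha n" unfolding alpha_def le_floor_iff .
    have al': "6 \<le> alpha n" "5 \<le> alpha n" using al by simp_all
    have mean: "10 ^ 16 \<le> real_of_int K" "28/10 \<le> of_int (alpha n) - real n / of_int K"
      "of_int (alpha n) - real n / of_int K \<le> 395/100"
      using mean_type_bounds[OF _ _ _ _ r K] elim(2) by blast+
    then have K0: "0 < real_of_int K" by simp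
    let ?x = "\<lambda>i. of_int K * p i"
    have feas: "?x \<in> feasible_points n (of_int K)"
      using opt by (simp add: is_L_maximizer_def K_def)
    have nonneg: "0 \<le> p i" if "i \<in> {2..5}" for i
      using feas that K0 by (auto simp: feasible_points_def zero_le_mult_iff)
    have sumx: "(\<Sum>i=2..5. ?x i) = of_int K"
      using feas by (simp add: feasible_points_def)
    then have sum: "(\<Sum>i=2..5. p i) = 1" using K0 by (simp flip: sum_distrib_left)
    have meanx: "(\<Sum>i=2..5. real i * ?x i) = of_int (alpha n) * of_int K - real n"
      by (rule sum_weighted_feasible[OF feas al'(2)])
    then have "of_int K * (\<Sum>i=2..5. real i * p i) = of_int K * (of_int (alpha n) - real n / of_int K)"
      using K0 by (simp add: sum_distrib_left right_diff_distrib ac_simps)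
    then have meanp: "(\<Sum>i=2..5. real i * p i) = of_int (alpha n) - real n / of_int K"
      using K0 by simp
    note rel = maximizer_relations[OF opt al'(1), folded K_def]
    have big: "1 / 10 ^ 14 \<le> p i" if "i \<in> {2..5}" for i
    proof (rule profile_weights_bounded_below[OF _ _ _ _ _ _ _ _ _ _ _ that])
      show "(p 3)\<^sup>2 \<le> 4 * p 2 * p 4" "p 2 * p 4 \<le> (p 3)\<^sup>2" "(p 4)\<^sup>2 \<le> 4 * p 3 * p 5"
        "p 2 * p 5 \<le> p 3 * p 4"
        using rel K0 by (simp_all add: power_mult_distrib power2_eq_square ac_simps)
    qed (use nonneg sum meanp mean in \<open>auto simp: sum_2_5\<close>)
    have bigx: "100 \<le> ?x i" if "i \<in> {2..5}" for i
      using mult_mono[OF mean(1) big[OF that]] K0 by simp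
    have d: "\<bar>of_int (kt 2) - ?x 2\<bar> \<le> (1::real)" "\<bar>of_int (kt 3) - ?x 3\<bar> \<le> (1::real)"
      "\<bar>of_int (kt 4) - ?x 4\<bar> \<le> (1::real)" "\<bar>of_int (kt 5) - ?x 5\<bar> \<le> (1::real)"
      using kt by (auto simp: K_def)
    have "real_of_int e0 = (\<Sum>i=2..5. of_int (kt i)) - of_int K"
      by (simp add: e0 K_def)
    then have e0b: "\<bar>real_of_int e0\<bar> \<le> 4"
      using sumx d unfolding sum_2_5 by linarith
    have "real_of_int e1 = (\<Sum>i=2..5. real i * of_int (kt i)) - (of_int (alpha n) * of_int K - real n)"
      by (simp add: e1 K_def)
    \<comment> \<open>14 = 2 + 3 + 4 + 5 is the sum of the four rounding errors weighted by their
      types.\<close>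
    then have e1b: "\<bar>real_of_int e1\<bar> \<le> 14"
      using meanx d unfolding sum_2_5 by simp
    have kpos: "0 \<le> k i" if i: "i \<in> {2..5}" for i
    proof -
      have "i = 2 \<or> i = 3 \<or> i = 4 \<or> i = 5" using i by auto
      then have "0 \<le> real_of_int (k i)"
        using d bigx[of 2] bigx[of 3] bigx[of 4] bigx[of 5] e0b e1b k by auto
      then show ?thesis by simp
    qed
    \<comment> \<open>The corrections \<open>e1 - 3 * e0\<close> and \<open>2 * e0 - e1\<close>
      solve the two linear equations that remove the excess \<open>e0\<close> from the count and
      \<open>e1\<close> from the weighted count by changing types 2 and 3 alone.\<close>
    have ks: "(\<Sum>i=2..5. k i) = K"
      using e0 k by (simp add: sum_2_5 K_def)
    have "(\<Sum>i=2..5. int i * k i) = alpha n * K - int n"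
      using e0 e1 k by (simp add: sum_2_5 K_def)
    moreover have "(\<Sum>i=2..5. int (class_size n i) * k i) = (\<Sum>i=2..5. alpha n * k i - int i * k i)"
      using al by (intro sum.cong refl) (simp add: class_size_def left_diff_distrib)
    ultimately have "(\<Sum>i=2..5. int (class_size n i) * k i) = int n"
      using ks by (simp add: sum_subtractf flip: sum_distrib_left)
    then show "valid_profile n (k_co A n) k"
      using kpos ks al by (simp add: valid_profile_def K_def)
  qed
qed

section \<open>Realizing declarations\<close>

definition pairs :: "nat set \<Rightarrow> nat set set" where
  "pairs C = {e. e \<subseteq> C \<and> card e = 2}"

lemma finite_pairs: "finite C \<Longrightarrow> finite (pairs C)"
  by (simp add: pairs_def)

lemma card_pairs: "finite C \<Longrightarrow> card (pairs C) = card C choose 2"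
  by (simp add: pairs_def n_subsets)

lemma pairs_subset_vertex_pairs: "C \<subseteq> {1..n} \<Longrightarrow> pairs C \<subseteq> vertex_pairs n"
  by (auto simp: pairs_def vertex_pairs_def)

lemma pairs_Int: "pairs C \<inter> pairs D = pairs (C \<inter> D)"
  by (auto simp: pairs_def)

lemma pairs_disjoint: "C \<inter> D = {} \<Longrightarrow> pairs C \<inter> pairs D = {}"
  by (auto simp: pairs_Int) (auto simp: pairs_def)

lemma pairs_eq_empty_iff: "finite C \<Longrightarrow> pairs C = {} \<longleftrightarrow> card C < 2"
  by (metis binomial_eq_0_iff card_0_eq card_pairs finite_pairs)

lemma realizes_iff: "realizes G d C \<longleftrightarrow> (\<forall>e\<in>pairs C. G e \<longleftrightarrow> d = Complete)"
  by (cases d) (auto simp: pairs_def)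

text \<open>The event is a box in the product space: a factor 1/2 for each pair in \<open>E\<close>
  and a factor 1 for every other pair.\<close>

lemma prob_random_graph_prescribed:
  assumes "E \<subseteq> vertex_pairs n"
  shows "measure_pmf.prob (random_graph n) {G. \<forall>e\<in>E. G e \<longleftrightarrow> h e} = 1 / 2 ^ card E"
proof -
  have fin: "finite (vertex_pairs n)"
    unfolding vertex_pairs_def by simp
  have "{G. \<forall>e\<in>E. G e \<longleftrightarrow> h e} = Pi (vertex_pairs n) (\<lambda>e. if e \<in> E then {h e} else UNIV)"
    using assms by (auto simp: Pi_def)
  then have "measure_pmf.prob (random_graph n) {G. \<forall>e\<in>E. G e \<longleftrightarrow> h e}
      = (\<Prod>e\<in>vertex_pairs n. measure_pmf.prob (bernoulli_pmf (1/2)) (if e \<in> E then {h e} else UNIV))"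
    unfolding random_graph_def by (simp add: measure_Pi_pmf_Pi[OF fin])
  also have "\<dots> = (\<Prod>e\<in>vertex_pairs n. if e \<in> E then 1/2 else 1)"
  proof (intro prod.cong refl)
    fix e
    show "measure_pmf.prob (bernoulli_pmf (1/2)) (if e \<in> E then {h e} else UNIV)
        = (if e \<in> E then 1/2 else 1)"
      by (cases "h e") (auto simp: measure_pmf_single)
  qed
  also have "\<dots> = (\<Prod>e\<in>E. 1/2)"
    using assms fin by (simp add: prod.If_cases Int_absorb1)
  finally show ?thesis by (simp add: power_one_over)
qed

lemma ordered_partitions_finite_class:
  assumes "V \<in> ordered_partitions n I s"
  shows "finite (V a)"
proof (cases "a \<in> I")
  case True
  then have "V a \<subseteq> {1..n}" using assms by (auto simp: ordered_partitions_def)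
  then show ?thesis by (rule finite_subset) simp
qed (use assms in \<open>auto simp: ordered_partitions_def\<close>)

lemma ordered_partitions_subset:
  assumes "V \<in> ordered_partitions n I s"
  shows "V a \<subseteq> {1..n}"
  by (cases "a \<in> I") (use assms in \<open>auto simp: ordered_partitions_def\<close>)

lemma ordered_partitions_disjoint:
  assumes "V \<in> ordered_partitions n I s" "a \<in> I" "a' \<in> I" "a \<noteq> a'"
  shows "V a \<inter> V a' = {}"
  using assms unfolding ordered_partitions_def by (blast dest: disjoint_family_onD)

lemma ordered_partitions_pairs_unique:
  assumes V: "V \<in> ordered_partitions n I s" and "a \<in> I" "a' \<in> I"
    and e: "e \<in> pairs (V a)" "e \<in> pairs (V a')"
  shows "a = a'"
proof (rule ccontr)
  assume "a \<noteq> a'"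
  then have "V a \<inter> V a' = {}"
    using ordered_partitions_disjoint[OF V] assms by blast
  then show False using pairs_disjoint e by blast
qed

lemma card_covered_pairs:
  assumes V: "V \<in> ordered_partitions n I s" and I: "finite I"
  shows "card (\<Union>a\<in>I. pairs (V a)) = (\<Sum>a\<in>I. s a choose 2)"
proof -
  have "card (\<Union>a\<in>I. pairs (V a)) = (\<Sum>a\<in>I. card (pairs (V a)))"
  proof (intro card_UN_disjoint I ballI impI)
    fix a a' assume "a \<in> I" "a' \<in> I" "a \<noteq> a'"
    then show "pairs (V a) \<inter> pairs (V a') = {}"
      by (intro pairs_disjoint ordered_partitions_disjoint[OF V])
  qed (rule finite_pairs[OF ordered_partitions_finite_class[OF V]])
  also have "\<dots> = (\<Sum>a\<in>I. s a choose 2)"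
    using V by (intro sum.cong refl)
      (simp add: card_pairs ordered_partitions_finite_class[OF V], simp add: ordered_partitions_def)
  finally show ?thesis .
qed

lemma card_common_pairs:
  assumes V: "V \<in> ordered_partitions n I s" and W: "W \<in> ordered_partitions n J t"
    and fin: "finite I" "finite J"
  shows "card ((\<Union>a\<in>I. pairs (V a)) \<inter> (\<Union>b\<in>J. pairs (W b))) = overlap_weight I J (overlap V W)"
proof -
  let ?c = "\<lambda>p. V (fst p) \<inter> W (snd p)"
  have finc: "finite (?c p)" for p
    using ordered_partitions_finite_class[OF V] by blast
  have "(\<Union>a\<in>I. pairs (V a)) \<inter> (\<Union>b\<in>J. pairs (W b)) = (\<Union>p\<in>I \<times> J. pairs (?c p))"
    unfolding pairs_Int[symmetric] by force
  also have "card \<dots> = (\<Sum>p\<in>I \<times> J. card (pairs (?c p)))"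
  proof (rule card_UN_disjoint)
    show "\<forall>p\<in>I \<times> J. \<forall>q\<in>I \<times> J. p \<noteq> q \<longrightarrow> pairs (?c p) \<inter> pairs (?c q) = {}"
    proof (intro ballI impI pairs_disjoint)
      fix p q assume "p \<in> I \<times> J" "q \<in> I \<times> J" "p \<noteq> q"
      then have "V (fst p) \<inter> V (fst q) = {} \<or> W (snd p) \<inter> W (snd q) = {}"
        using ordered_partitions_disjoint[OF V] ordered_partitions_disjoint[OF W]
        by (metis mem_Times_iff prod_eq_iff)
      then show "?c p \<inter> ?c q = {}" by blast
    qed
  qed (use fin finc in \<open>auto simp: finite_pairs\<close>)
  also have "\<dots> = (\<Sum>(a,b)\<in>I \<times> J. overlap V W a b choose 2)"
    using finc by (intro sum.cong refl) (auto simp: card_pairs overlap_def)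
  finally show ?thesis by (simp add: overlap_weight_def sum.cartesian_product)
qed

lemma prob_realizes_one:
  assumes V: "V \<in> ordered_partitions n I s" and I: "finite I"
  shows "measure_pmf.prob (random_graph n) {G. \<forall>a\<in>I. realizes G (\<sigma> a) (V a)}
    = 1 / 2 ^ (\<Sum>a\<in>I. s a choose 2)"
proof -
  define h where "h e \<longleftrightarrow> (\<exists>a\<in>I. e \<in> pairs (V a) \<and> \<sigma> a = Complete)" for e
  have uniq: "a = a'" if "a \<in> I" "a' \<in> I" "e \<in> pairs (V a)" "e \<in> pairs (V a')" for a a' e
    using ordered_partitions_pairs_unique[OF V] that by blast
  have h: "h e \<longleftrightarrow> \<sigma> a = Complete" if "a \<in> I" "e \<in> pairs (V a)" for a e
  proof
    assume "h e"
    then obtain a' where "a' \<in> I" "e \<in> pairs (V a')" "\<sigma> a' = Complete"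
      unfolding h_def by blast
    moreover from this have "a = a'" using uniq that by blast
    ultimately show "\<sigma> a = Complete" by simp
  qed (use that in \<open>auto simp: h_def\<close>)
  have "{G. \<forall>a\<in>I. realizes G (\<sigma> a) (V a)} = {G. \<forall>e\<in>(\<Union>a\<in>I. pairs (V a)). G e \<longleftrightarrow> h e}"
    unfolding realizes_iff by (intro Collect_cong) (auto simp: h)
  moreover have "(\<Union>a\<in>I. pairs (V a)) \<subseteq> vertex_pairs n"
    by (intro UN_least pairs_subset_vertex_pairs ordered_partitions_subset[OF V])
  ultimately show ?thesis
    by (simp only: prob_random_graph_prescribed card_covered_pairs[OF V I])
qed

text \<open>Agreement on all cells with two or more points merges the two prescriptions into a
  single function \<open>h\<close> on the covered pairs, whose number is found by
  inclusion-exclusion. Disagreement on one such cell requires some pair to be both an edge and a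
  non-edge.\<close>

lemma prob_realizes_two:
  assumes V: "V \<in> ordered_partitions n I s" and W: "W \<in> ordered_partitions n J t"
    and fin: "finite I" "finite J"
  shows "measure_pmf.prob (random_graph n)
      {G. (\<forall>a\<in>I. realizes G (\<sigma> a) (V a)) \<and> (\<forall>b\<in>J. realizes G (\<tau> b) (W b))}
    = (if \<forall>a\<in>I. \<forall>b\<in>J. 2 \<le> overlap V W a b \<longrightarrow> \<sigma> a = \<tau> b
       then 2 ^ overlap_weight I J (overlap V W)
            / (2 ^ (\<Sum>a\<in>I. s a choose 2) * 2 ^ (\<Sum>b\<in>J. t b choose 2))
       else 0)" (is "measure_pmf.prob _ ?S = (if ?C then _ else _)")
proof (cases ?C)
  case True
  let ?E = "\<Union>a\<in>I. pairs (V a)" and ?F = "\<Union>b\<in>J. pairs (W b)"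
  define h where "h e \<longleftrightarrow> (\<exists>a\<in>I. e \<in> pairs (V a) \<and> \<sigma> a = Complete)
      \<or> (\<exists>b\<in>J. e \<in> pairs (W b) \<and> \<tau> b = Complete)" for e
  have uniqV: "a = a'" if "a \<in> I" "a' \<in> I" "e \<in> pairs (V a)" "e \<in> pairs (V a')" for a a' e
    using ordered_partitions_pairs_unique[OF V] that by blast
  have uniqW: "a = a'" if "a \<in> J" "a' \<in> J" "e \<in> pairs (W a)" "e \<in> pairs (W a')" for a a' e
    using ordered_partitions_pairs_unique[OF W] that by blast
  have cons: "\<sigma> a = \<tau> b" if "a \<in> I" "b \<in> J" "e \<in> pairs (V a)" "e \<in> pairs (W b)" for a b e
  proof -
    have "e \<in> pairs (V a \<inter> W b)" using that by (auto simp: pairs_def)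
    then have "pairs (V a \<inter> W b) \<noteq> {}" by blast
    then have "2 \<le> overlap V W a b"
      using ordered_partitions_finite_class[OF V]
      by (subst (asm) pairs_eq_empty_iff) (auto simp: overlap_def)
    then show ?thesis using True that by blast
  qed
  have hV: "h e \<longleftrightarrow> \<sigma> a = Complete" if "a \<in> I" "e \<in> pairs (V a)" for a e
  proof
    assume "h e"
    then consider a' where "a' \<in> I" "e \<in> pairs (V a')" "\<sigma> a' = Complete"
      | b where "b \<in> J" "e \<in> pairs (W b)" "\<tau> b = Complete"
      unfolding h_def by blast
    then show "\<sigma> a = Complete"
    proof cases
      case 1
      then have "a = a'" using uniqV that by blast
      then show ?thesis using 1 by simp
    next
      case 2
      then have "\<sigma> a = \<tau> b" using cons that by blast
      then show ?thesis using 2 by simp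
    qed
  qed (use that in \<open>auto simp: h_def\<close>)
  have hW: "h e \<longleftrightarrow> \<tau> b = Complete" if "b \<in> J" "e \<in> pairs (W b)" for b e
  proof
    assume "h e"
    then consider b' where "b' \<in> J" "e \<in> pairs (W b')" "\<tau> b' = Complete"
      | a where "a \<in> I" "e \<in> pairs (V a)" "\<sigma> a = Complete"
      unfolding h_def by blast
    then show "\<tau> b = Complete"
    proof cases
      case 1
      then have "b = b'" using uniqW that by blast
      then show ?thesis using 1 by simp
    next
      case 2
      then have "\<sigma> a = \<tau> b" using cons that by blast
      then show ?thesis using 2 by simp
    qed
  qed (use that in \<open>auto simp: h_def\<close>)
  have "?S = {G. \<forall>e\<in>?E \<union> ?F. G e \<longleftrightarrow> h e}"
    unfolding realizes_iff by (intro Collect_cong) (simp add: ball_Un hV hW)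
  moreover have "?E \<union> ?F \<subseteq> vertex_pairs n"
    by (intro Un_least UN_least pairs_subset_vertex_pairs
        ordered_partitions_subset[OF V] ordered_partitions_subset[OF W])
  ultimately have "measure_pmf.prob (random_graph n) ?S = 1 / 2 ^ card (?E \<union> ?F)"
    by (simp only: prob_random_graph_prescribed)
  moreover have "card (?E \<union> ?F) + overlap_weight I J (overlap V W)
      = (\<Sum>a\<in>I. s a choose 2) + (\<Sum>b\<in>J. t b choose 2)"
  proof -
    have "finite ?E" "finite ?F"
      using fin ordered_partitions_finite_class[OF V] ordered_partitions_finite_class[OF W]
      by (auto simp: finite_pairs)
    then have "card (?E \<union> ?F) + card (?E \<inter> ?F) = card ?E + card ?F"
      using card_Un_Int by metis
    then show ?thesis
      using card_covered_pairs[OF V fin(1)] card_covered_pairs[OF W fin(2)]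
        card_common_pairs[OF V W fin] by simp
  qed
  then have e: "(2::real) ^ card (?E \<union> ?F) * 2 ^ overlap_weight I J (overlap V W)
      = 2 ^ (\<Sum>a\<in>I. s a choose 2) * 2 ^ (\<Sum>b\<in>J. t b choose 2)"
    by (metis power_add)
  have "(1::real) / 2 ^ card (?E \<union> ?F) = 2 ^ overlap_weight I J (overlap V W)
      / (2 ^ (\<Sum>a\<in>I. s a choose 2) * 2 ^ (\<Sum>b\<in>J. t b choose 2))"
    by (subst e[symmetric]) simp
  ultimately show ?thesis
    by (simp only: if_P[OF True])
next
  case False
  then obtain a b where ab: "a \<in> I" "b \<in> J" "2 \<le> overlap V W a b" "\<sigma> a \<noteq> \<tau> b" by blast
  then have "pairs (V a \<inter> W b) \<noteq> {}"
    using ordered_partitions_finite_class[OF V]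
    by (subst pairs_eq_empty_iff) (auto simp: overlap_def)
  then obtain e where e: "e \<in> pairs (V a)" "e \<in> pairs (W b)"
    by (auto simp: pairs_Int[symmetric])
  have "\<sigma> a = Complete \<longleftrightarrow> \<tau> b \<noteq> Complete"
    using ab(4) by (cases "\<sigma> a"; cases "\<tau> b") auto
  then have S: "?S = {}"
    unfolding realizes_iff using ab e by blast
  show ?thesis unfolding S if_not_P[OF False] by simp
qed

section \<open>Declarations constant on the components of the support graph\<close>

lemma locally_constant_rtrancl:
  assumes "\<forall>(x, y)\<in>R. f x = f y" "(x, y) \<in> R\<^sup>*"
  shows "f x = f y"
  using assms(2) by (induction rule: rtrancl_induct) (use assms(1) in auto)

text \<open>Symmetry of \<open>R\<close> makes its reflexive transitive closure an equivalence, and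
  a function constant along \<open>R\<close> is constant on the classes. Such functions therefore
  correspond to arbitrary functions on the quotient.\<close>

lemma card_locally_constant:
  fixes R :: "('x \<times> 'x) set"
  assumes fin: "finite X" and R: "R \<subseteq> X \<times> X" "sym R"
  shows "card {f \<in> X \<rightarrow>\<^sub>E (UNIV :: 'c::finite set). \<forall>(x, y)\<in>R. f x = f y}
    = CARD('c) ^ card (X // R\<^sup>*)"
proof -
  let ?F = "{f \<in> X \<rightarrow>\<^sub>E (UNIV :: 'c set). \<forall>(x, y)\<in>R. f x = f y}"
  let ?cl = "\<lambda>x. R\<^sup>* `` {x}"
  let ?h = "\<lambda>g. \<lambda>x\<in>X. g (?cl x)"
  have eq: "equiv UNIV (R\<^sup>*)"
    using R(2) by (intro equivI refl_rtrancl sym_rtrancl trans_rtrancl) auto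
  have cl_eq: "?cl x = ?cl y" if "(x, y) \<in> R\<^sup>*" for x y
    using equiv_class_eq[OF eq that] .
  have "bij_betw ?h (X // R\<^sup>* \<rightarrow>\<^sub>E (UNIV :: 'c set)) ?F"
    unfolding bij_betw_def
  proof (intro conjI inj_onI equalityI subsetI)
    fix g g' assume g: "g \<in> X // R\<^sup>* \<rightarrow>\<^sub>E UNIV" "g' \<in> X // R\<^sup>* \<rightarrow>\<^sub>E (UNIV :: 'c set)" and e: "?h g = ?h g'"
    show "g = g'"
    proof (rule PiE_ext[OF g])
      fix C assume "C \<in> X // R\<^sup>*"
      then obtain x where x: "x \<in> X" "C = ?cl x" by (auto simp: quotient_def)
      have "?h g x = ?h g' x" using e by (rule fun_cong)
      then show "g C = g' C" using x by simp
    qed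
  next
    fix f assume "f \<in> ?h ` (X // R\<^sup>* \<rightarrow>\<^sub>E (UNIV :: 'c set))"
    then obtain g where f: "f = ?h g" by blast
    have "f x = f y" if "(x, y) \<in> R" for x y
    proof -
      have "x \<in> X" "y \<in> X" "?cl x = ?cl y" using that R(1) by (auto intro!: cl_eq)
      then show ?thesis by (simp only: f restrict_apply' )
    qed
    then show "f \<in> ?F" by (auto simp: f)
  next
    fix f assume f: "f \<in> ?F"
    \<comment> \<open>Any representative of the class gives the same value, since \<open>f\<close>
      is constant on it.\<close>
    define g where "g = (\<lambda>C\<in>X // R\<^sup>*. f (SOME x. x \<in> C))"
    have "f x = ?h g x" for x
    proof (cases "x \<in> X")
      case True
      have "(SOME y. y \<in> ?cl x) \<in> ?cl x" by (rule someI[of _ x]) simp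
      then have "(x, SOME y. y \<in> ?cl x) \<in> R\<^sup>*" by simp
      then have "f x = f (SOME y. y \<in> ?cl x)"
        using f by (intro locally_constant_rtrancl) auto
      then show ?thesis using True by (simp add: g_def quotientI)
    next
      case False
      then show ?thesis using f by (auto simp: PiE_def extensional_def)
    qed
    then have "f = ?h g" by (rule ext)
    moreover have "g \<in> X // R\<^sup>* \<rightarrow>\<^sub>E UNIV" by (simp add: g_def)
    ultimately show "f \<in> ?h ` (X // R\<^sup>* \<rightarrow>\<^sub>E (UNIV :: 'c set))" by blast
  qed
  then have "card ?F = card (X // R\<^sup>* \<rightarrow>\<^sub>E (UNIV :: 'c set))"
    by (rule bij_betw_same_card[symmetric])
  also have "\<dots> = CARD('c) ^ card (X // R\<^sup>*)"
    using fin by (simp add: card_PiE finite_quotient quotient_def)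
  finally show ?thesis .
qed

lemma H_edges_subset:
  assumes "r \<in> overlap_matrices I J s t"
  shows "H_edges r \<subseteq> I \<times> J"
proof -
  have "r a b = 0" if "a \<notin> I \<or> b \<notin> J" for a b
    using assms that unfolding overlap_matrices_def by blast
  then have "a \<in> I \<and> b \<in> J" if "2 \<le> r a b" for a b
    using that by (metis not_numeral_le_zero)
  then show ?thesis by (auto simp: H_edges_def)
qed

lemma H_vertices_subset:
  assumes "H_edges r \<subseteq> I \<times> J"
  shows "H_vertices r \<subseteq> I <+> J"
  using assms unfolding H_vertices_def by auto

lemma H_adjacency_subset: "H_adjacency r \<subseteq> H_vertices r \<times> H_vertices r"
  unfolding H_adjacency_def H_vertices_def by fastforce

lemma sym_H_adjacency: "sym (H_adjacency r)"
  unfolding H_adjacency_def by (auto intro!: symI)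

text \<open>Points outside \<open>Y\<close> are related only to themselves and form singleton
  classes. The vertices of \<open>H\<close> are only the slots incident to an edge, whereas
  declarations live on all slots; the free choices on the remaining slots enter through
  \<open>X - Y\<close>.\<close>

lemma card_quotient_isolated:
  assumes fin: "finite X" and Y: "Y \<subseteq> X" and R: "R \<subseteq> Y \<times> Y"
  shows "card (X // R\<^sup>*) = card (Y // R\<^sup>*) + card (X - Y)"
proof -
  have iso: "R\<^sup>* `` {x} = {x}" if "x \<in> X - Y" for x
  proof -
    have "y = x" if "(x, y) \<in> R\<^sup>*" for y
      using that \<open>x \<in> X - Y\<close> R by (auto elim: converse_rtranclE)
    then show ?thesis by auto
  qed
  have "X // R\<^sup>* = (Y // R\<^sup>*) \<union> ((X - Y) // R\<^sup>*)"
    using Y by (auto simp: quotient_def)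
  also have "(X - Y) // R\<^sup>* = (\<lambda>x. {x}) ` (X - Y)"
    using iso by (auto simp: quotient_def)
  finally have split: "X // R\<^sup>* = (Y // R\<^sup>*) \<union> (\<lambda>x. {x}) ` (X - Y)" .
  have "{x} \<noteq> R\<^sup>* `` {y}" if "x \<in> X - Y" "y \<in> Y" for x y
  proof
    assume e: "{x} = R\<^sup>* `` {y}"
    have "y \<in> R\<^sup>* `` {y}" by simp
    then have "x = y" unfolding e[symmetric] by simp
    then show False using that by blast
  qed
  then have "(Y // R\<^sup>*) \<inter> (\<lambda>x. {x}) ` (X - Y) = {}"
    unfolding quotient_def by blast
  moreover have "finite (Y // R\<^sup>*)"
    using finite_subset[OF Y fin] by (simp add: quotient_def)
  ultimately have "card (X // R\<^sup>*) = card (Y // R\<^sup>*) + card ((\<lambda>x. {x}) ` (X - Y))"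
    unfolding split using fin by (intro card_Un_disjoint) auto
  then show ?thesis by (simp add: card_image)
qed

lemma UNIV_class_decl: "UNIV = {Independent, Complete}"
  using class_decl.exhaust by auto

instance class_decl :: finite
  by standard (simp add: UNIV_class_decl)

lemma card_class_decl: "CARD(class_decl) = 2"
  by (simp add: UNIV_class_decl)

text \<open>A pair of declaration maps is one map on the disjoint union of rows and columns, and
  consistency says that it is constant along \<open>H_adjacency r\<close>. The vertex factor stands
  on the left to avoid subtraction of natural numbers.\<close>

lemma card_consistent_declarations:
  fixes I :: "'a set" and J :: "'b set"
  assumes fin: "finite I" "finite J" and H: "H_edges r \<subseteq> I \<times> J"
  shows "card {(\<sigma>, \<tau>) \<in> (I \<rightarrow>\<^sub>E (UNIV :: class_decl set)) \<times> (J \<rightarrow>\<^sub>E UNIV).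
        \<forall>a\<in>I. \<forall>b\<in>J. 2 \<le> r a b \<longrightarrow> \<sigma> a = \<tau> b} * 2 ^ card (H_vertices r)
    = 2 ^ (card I + card J + card (H_components r))"
proof -
  let ?S = "{(\<sigma>, \<tau>) \<in> (I \<rightarrow>\<^sub>E (UNIV :: class_decl set)) \<times> (J \<rightarrow>\<^sub>E UNIV).
        \<forall>a\<in>I. \<forall>b\<in>J. 2 \<le> r a b \<longrightarrow> \<sigma> a = \<tau> b}"
  let ?X = "I <+> J" and ?R = "H_adjacency r"
  let ?F = "{f \<in> ?X \<rightarrow>\<^sub>E (UNIV :: class_decl set). \<forall>(x, y)\<in>?R. f x = f y}"
  have finX: "finite ?X" using fin by simp
  have V: "H_vertices r \<subseteq> ?X" using H by (rule H_vertices_subset)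
  have adj: "(\<forall>(x, y)\<in>?R. f x = f y) \<longleftrightarrow> (\<forall>a\<in>I. \<forall>b\<in>J. 2 \<le> r a b \<longrightarrow> f (Inl a) = f (Inr b))"
    for f :: "'a + 'b \<Rightarrow> class_decl"
  proof
    assume *: "\<forall>(x, y)\<in>?R. f x = f y"
    have "(Inl a, Inr b) \<in> ?R" if "2 \<le> r a b" for a b
      using that unfolding H_adjacency_def H_edges_def by blast
    then show "\<forall>a\<in>I. \<forall>b\<in>J. 2 \<le> r a b \<longrightarrow> f (Inl a) = f (Inr b)"
      using * by blast
  next
    assume *: "\<forall>a\<in>I. \<forall>b\<in>J. 2 \<le> r a b \<longrightarrow> f (Inl a) = f (Inr b)"
    then have "f (Inl a) = f (Inr b)" if "(a, b) \<in> H_edges r" for a b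
      using that H unfolding H_edges_def by blast
    then show "\<forall>(x, y)\<in>?R. f x = f y"
      unfolding H_adjacency_def by auto
  qed
  have "bij_betw (\<lambda>f. (\<lambda>a\<in>I. f (Inl a), \<lambda>b\<in>J. f (Inr b))) ?F ?S"
  proof (rule bij_betw_byWitness[where f' = "\<lambda>(\<sigma>, \<tau>). \<lambda>x\<in>?X. case x of Inl a \<Rightarrow> \<sigma> a | Inr b \<Rightarrow> \<tau> b"])
    show "\<forall>f\<in>?F. (\<lambda>(\<sigma>, \<tau>). \<lambda>x\<in>?X. case x of Inl a \<Rightarrow> \<sigma> a | Inr b \<Rightarrow> \<tau> b)
        (\<lambda>a\<in>I. f (Inl a), \<lambda>b\<in>J. f (Inr b)) = f"
    proof
      fix f assume "f \<in> ?F"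
      then have f: "f x = undefined" if "x \<notin> ?X" for x
        using that by (auto simp: PiE_def extensional_def)
      show "(\<lambda>(\<sigma>, \<tau>). \<lambda>x\<in>?X. case x of Inl a \<Rightarrow> \<sigma> a | Inr b \<Rightarrow> \<tau> b)
        (\<lambda>a\<in>I. f (Inl a), \<lambda>b\<in>J. f (Inr b)) = f"
        by (rule ext) (use f in \<open>auto split: sum.split\<close>)
    qed
    show "\<forall>p\<in>?S. (\<lambda>f. (\<lambda>a\<in>I. f (Inl a), \<lambda>b\<in>J. f (Inr b)))
        ((\<lambda>(\<sigma>, \<tau>). \<lambda>x\<in>?X. case x of Inl a \<Rightarrow> \<sigma> a | Inr b \<Rightarrow> \<tau> b) p) = p"
      by (auto simp: fun_eq_iff PiE_def extensional_def)
    show "(\<lambda>f. (\<lambda>a\<in>I. f (Inl a), \<lambda>b\<in>J. f (Inr b))) ` ?F \<subseteq> ?S"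
      unfolding adj by auto
    show "(\<lambda>(\<sigma>, \<tau>). \<lambda>x\<in>?X. case x of Inl a \<Rightarrow> \<sigma> a | Inr b \<Rightarrow> \<tau> b) ` ?S \<subseteq> ?F"
      unfolding adj by auto
  qed
  then have "card ?S = card ?F" by (rule bij_betw_same_card[symmetric])
  also have "\<dots> = 2 ^ card (?X // ?R\<^sup>*)"
    using card_locally_constant[OF finX _ sym_H_adjacency, of r, where 'c = class_decl]
      H_adjacency_subset[of r] V by (simp add: card_class_decl order_trans[OF _ Sigma_mono])
  also have "card (?X // ?R\<^sup>*) = card (H_components r) + card (?X - H_vertices r)"
    unfolding H_components_def by (rule card_quotient_isolated[OF finX V H_adjacency_subset])
  finally have S: "card ?S = 2 ^ (card (H_components r) + card (?X - H_vertices r))" .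
  have "card (?X - H_vertices r) + card (H_vertices r) = card I + card J"
    using card_Diff_subset[OF finite_subset[OF V finX] V] card_mono[OF finX V] fin
    by (simp add: card_Plus)
  then show ?thesis
    unfolding S power_add[symmetric] by (simp add: ac_simps)
qed

text \<open>All consistent pairs of declarations have the same probability, so the numerator is a
  count times a constant. The powers of 2 coming from the number of slots and from the class sizes
  cancel against the normalization, and only the overlap matrix survives; hence all pairs with this
  matrix share one factor.\<close>

lemma pair_local_factor_eq:
  assumes V: "V \<in> ordered_partitions n I s" and W: "W \<in> ordered_partitions n J t"
    and fin: "finite I" "finite J" and K: "K = int (card I)" "K = int (card J)"
    and st: "(\<Sum>a\<in>I. s a choose 2) = (\<Sum>b\<in>J. t b choose 2)"
    and H: "H_edges (overlap V W) \<subseteq> I \<times> J"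
  shows "pair_local_factor n K I J V W
    = 2 powi (int (overlap_weight I J (overlap V W)) + int (card (H_components (overlap V W)))
        - int (card (H_vertices (overlap V W))))"
proof -
  let ?r = "overlap V W"
  let ?D = "(I \<rightarrow>\<^sub>E (UNIV :: class_decl set)) \<times> (J \<rightarrow>\<^sub>E (UNIV :: class_decl set))"
  let ?B = "\<Sum>a\<in>I. s a choose 2"
  define cons where "cons = {(\<sigma>, \<tau>) \<in> ?D. \<forall>a\<in>I. \<forall>b\<in>J. 2 \<le> ?r a b \<longrightarrow> \<sigma> a = \<tau> b}"
  have finD: "finite ?D" using fin by (simp add: finite_PiE)
  let ?c = "2 ^ overlap_weight I J ?r / (2 ^ ?B * 2 ^ ?B) :: real"
  have "(\<Sum>\<sigma> \<in> I \<rightarrow>\<^sub>E UNIV. \<Sum>\<tau> \<in> J \<rightarrow>\<^sub>E UNIV.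
        measure_pmf.prob (random_graph n)
          {G. (\<forall>a\<in>I. realizes G (\<sigma> a) (V a)) \<and> (\<forall>b\<in>J. realizes G (\<tau> b) (W b))})
      = (\<Sum>p\<in>?D. if p \<in> cons then ?c else 0)"
    unfolding sum.cartesian_product prob_realizes_two[OF V W fin] st[symmetric]
  proof (intro sum.cong refl)
    fix p assume "p \<in> ?D"
    then obtain \<sigma> \<tau> where p: "p = (\<sigma>, \<tau>)" "(\<sigma>, \<tau>) \<in> ?D" by (cases p) auto
    then have "p \<in> cons \<longleftrightarrow> (\<forall>a\<in>I. \<forall>b\<in>J. 2 \<le> ?r a b \<longrightarrow> \<sigma> a = \<tau> b)"
      by (simp add: cons_def)
    then show "(case p of (\<sigma>, \<tau>) \<Rightarrow> if \<forall>a\<in>I. \<forall>b\<in>J. 2 \<le> ?r a b \<longrightarrow> \<sigma> a = \<tau> b then ?c else 0)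
        = (if p \<in> cons then ?c else 0)"
      by (simp only: p(1) prod.case)
  qed
  also have "\<dots> = real (card cons) * ?c"
  proof -
    have "?D \<inter> cons = cons" by (auto simp: cons_def)
    then show ?thesis using finD by (simp add: sum.If_cases)
  qed
  finally have num: "(\<Sum>\<sigma> \<in> I \<rightarrow>\<^sub>E UNIV. \<Sum>\<tau> \<in> J \<rightarrow>\<^sub>E UNIV.
        measure_pmf.prob (random_graph n)
          {G. (\<forall>a\<in>I. realizes G (\<sigma> a) (V a)) \<and> (\<forall>b\<in>J. realizes G (\<tau> b) (W b))})
      = real (card cons) * ?c" .
  have "card cons * 2 ^ card (H_vertices ?r) = 2 ^ (card I + card J + card (H_components ?r))"
    unfolding cons_def by (rule card_consistent_declarations[OF fin H])
  then have "real (card cons * 2 ^ card (H_vertices ?r)) = real (2 ^ (card I + card J + card (H_components ?r)))"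
    by (rule arg_cong)
  then have cc: "real (card cons) * 2 ^ card (H_vertices ?r) = 2 ^ (card I + card J + card (H_components ?r))"
    by simp
  have B: "(\<Sum>a\<in>I. card (V a) choose 2) = ?B"
    using V by (intro sum.cong refl) (simp add: ordered_partitions_def)
  have den: "(2 powi K * 2 powi (- int ?B))\<^sup>2 = (2 ^ card I * 2 ^ card J / (2 ^ ?B * 2 ^ ?B) :: real)"
  proof -
    have "card J = card I" using K by simp
    then show ?thesis
      by (simp add: K(1) power_int_minus power2_eq_square field_simps del: of_nat_sum)
  qed
  have rhs: "(2::real) powi (int (overlap_weight I J ?r) + int (card (H_components ?r)) - int (card (H_vertices ?r)))
     = 2 ^ overlap_weight I J ?r * 2 ^ card (H_components ?r) / 2 ^ card (H_vertices ?r)"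
    by (simp add: power_int_diff power_int_add)
  have "real (card cons) = 2 ^ card I * 2 ^ card J * 2 ^ card (H_components ?r) / 2 ^ card (H_vertices ?r)"
    using cc by (simp add: power_add field_simps)
  then show ?thesis
    unfolding pair_local_factor_def num B den rhs by (simp add: field_simps)
qed

text \<open>\<open>g_weight\<close> takes one factor 2 away from every cell of size at least two.
  Collected over all cells these factors are \<open>2 ^ card (H_edges r)\<close>, which is how the
  number of edges enters \<open>H_beta r\<close>.\<close>

lemma g_weight_mult: "g_weight x * (if 2 \<le> x then 2 else 1) = 2 ^ (x choose 2)"
proof -
  consider "x \<le> 1" | "x = 2" | "3 \<le> x" by linarith
  then show ?thesis
  proof cases
    case 1
    then show ?thesis by (simp add: g_weight_def binomial_eq_0)
  next
    case 3
    then have "1 \<le> x choose 2"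
      using zero_less_binomial_iff[of x 2] by linarith
    then show ?thesis
      using 3 by (simp add: g_weight_def power_eq_if[of 2 "x choose 2"])
  qed (auto simp: g_weight_def)
qed

lemma overlap_weight_beta:
  assumes fin: "finite I" "finite J" and H: "H_edges r \<subseteq> I \<times> J"
  shows "(2::real) powi (int (overlap_weight I J r) + int (card (H_components r)) - int (card (H_vertices r)))
    = (\<Prod>a\<in>I. \<Prod>b\<in>J. g_weight (r a b)) * 2 powi (H_beta r)"
proof -
  have "(2::real) ^ overlap_weight I J r = (\<Prod>a\<in>I. \<Prod>b\<in>J. g_weight (r a b) * (if 2 \<le> r a b then 2 else 1))"
    by (simp add: overlap_weight_def power_sum g_weight_mult)
  also have "\<dots> = (\<Prod>a\<in>I. \<Prod>b\<in>J. g_weight (r a b)) * (\<Prod>(a, b)\<in>I \<times> J. if 2 \<le> r a b then 2 else 1)"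
    by (simp add: prod.distrib prod.cartesian_product)
  also have "(\<Prod>(a, b)\<in>I \<times> J. if 2 \<le> r a b then 2 else (1::real)) = (\<Prod>p\<in>I \<times> J. if p \<in> H_edges r then 2 else 1)"
    by (intro prod.cong refl) (auto simp: H_edges_def)
  also have "\<dots> = 2 ^ card (H_edges r)"
    using fin H by (simp add: prod.If_cases Int_absorb1)
  finally show ?thesis
    by (simp add: H_beta_def power_int_diff power_int_add)
qed

section \<open>Counting ordered partitions\<close>

text \<open>The ground set is left free so that an induction can split off one class and continue on
  the rest.\<close>

definition labelled_partitions :: "'v set \<Rightarrow> 'a set \<Rightarrow> ('a \<Rightarrow> nat) \<Rightarrow> ('a \<Rightarrow> 'v set) set" where
  "labelled_partitions S I s =
     {V. (\<forall>a. a \<notin> I \<longrightarrow> V a = {}) \<and> (\<forall>a\<in>I. card (V a) = s a)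
       \<and> disjoint_family_on V I \<and> (\<Union>a\<in>I. V a) = S}"

lemma ordered_partitions_eq: "ordered_partitions n I s = labelled_partitions {1..n} I s"
  by (simp add: ordered_partitions_def labelled_partitions_def)

text \<open>Choose the class of \<open>a\<close>, then partition the remainder. Resetting the value
  at \<open>a\<close> to the empty set respects the convention that the maps are empty off the index
  set, which makes the correspondence one to one.\<close>

lemma labelled_partitions_insert:
  assumes "a \<notin> I" "finite S"
  shows "bij_betw (\<lambda>(C, V). V(a := C))
    (SIGMA C:{C. C \<subseteq> S \<and> card C = s a}. labelled_partitions (S - C) I s)
    (labelled_partitions S (insert a I) s)"
proof (rule bij_betw_byWitness[where f' = "\<lambda>V. (V a, V(a := {}))"])
  let ?A = "SIGMA C:{C. C \<subseteq> S \<and> card C = s a}. labelled_partitions (S - C) I s"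
  show "\<forall>p\<in>?A. (\<lambda>V. (V a, V(a := {}))) ((\<lambda>(C, V). V(a := C)) p) = p"
    using assms(1) by (auto simp: labelled_partitions_def fun_eq_iff)
  show "\<forall>V\<in>labelled_partitions S (insert a I) s. (\<lambda>(C, V). V(a := C)) (V a, V(a := {})) = V"
    by simp
  show "(\<lambda>(C, V). V(a := C)) ` ?A \<subseteq> labelled_partitions S (insert a I) s"
  proof clarify
    fix C V assume C: "C \<subseteq> S" "card C = s a" and V: "V \<in> labelled_partitions (S - C) I s"
    have upd: "(V(a := C)) b = V b" if "b \<in> I" for b using that assms(1) by auto
    have un: "(\<Union>b\<in>I. V b) = S - C" using V by (simp add: labelled_partitions_def)
    have "disjoint_family_on (V(a := C)) (insert a I)"
      using V un assms(1) unfolding labelled_partitions_def disjoint_family_on_def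
      by (auto simp: fun_upd_def)
    moreover have "(\<Union>b\<in>insert a I. (V(a := C)) b) = S"
    proof -
      have "(\<Union>b\<in>I. (V(a := C)) b) = S - C"
        unfolding un[symmetric] using upd by (intro SUP_cong) auto
      then have "(\<Union>b\<in>insert a I. (V(a := C)) b) = C \<union> (S - C)"
        by (simp only: UN_insert fun_upd_same)
      then show ?thesis using C(1) by blast
    qed
    ultimately show "V(a := C) \<in> labelled_partitions S (insert a I) s"
      using V C assms(1) unfolding labelled_partitions_def by auto
  qed
  show "(\<lambda>V. (V a, V(a := {}))) ` labelled_partitions S (insert a I) s \<subseteq> ?A"
  proof (intro image_subsetI)
    fix V assume V: "V \<in> labelled_partitions S (insert a I) s"
    have "disjoint_family_on V (insert a I)" using V by (simp add: labelled_partitions_def)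
    then have disj: "V a \<inter> V b = {}" if "b \<in> I" for b
      using that assms(1) disjoint_family_onD[of V "insert a I" a b] by auto
    have "disjoint_family_on (V(a := {})) I"
      using V unfolding labelled_partitions_def disjoint_family_on_def by auto
    moreover have "(\<Union>b\<in>I. (V(a := {})) b) = S - V a"
    proof -
      have "(\<Union>b\<in>I. (V(a := {})) b) = (\<Union>b\<in>I. V b)"
        using assms(1) by (intro SUP_cong) auto
      moreover have "S = V a \<union> (\<Union>b\<in>I. V b)" using V by (auto simp: labelled_partitions_def)
      ultimately show ?thesis using disj by blast
    qed
    ultimately have "V(a := {}) \<in> labelled_partitions (S - V a) I s"
      using V assms(1) unfolding labelled_partitions_def by auto
    moreover have "V a \<subseteq> S" "card (V a) = s a" using V by (auto simp: labelled_partitions_def)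
    ultimately show "(V a, V(a := {})) \<in> ?A" by blast
  qed
qed

text \<open>The multinomial coefficient, built as a product of binomials by splitting off one class
  at a time and stated without division. Finiteness is carried along because the inductive step
  counts a dependent sum of finite sets.\<close>

lemma finite_card_labelled_partitions:
  assumes "finite I" "finite S"
  shows "finite (labelled_partitions S I s) \<and> ((\<Sum>a\<in>I. s a) = card S \<longrightarrow>
    card (labelled_partitions S I s) * (\<Prod>a\<in>I. fact (s a)) = fact (card S))"
  using assms
proof (induction I arbitrary: S rule: finite_induct)
  case empty
  have "labelled_partitions S {} s = (if S = {} then {\<lambda>_. {}} else {})"
    by (auto simp: labelled_partitions_def disjoint_family_on_def)
  then show ?case using empty by auto
next
  case (insert a I)
  let ?Cs = "{C. C \<subseteq> S \<and> card C = s a}"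
  have finC: "finite ?Cs" using insert.prems by simp
  have IH: "finite (labelled_partitions (S - C) I s)"
    "(\<Sum>b\<in>I. s b) = card (S - C) \<Longrightarrow>
      card (labelled_partitions (S - C) I s) * (\<Prod>b\<in>I. fact (s b)) = fact (card (S - C))" for C
    using insert.IH[of "S - C"] insert.prems by auto
  note bij = labelled_partitions_insert[OF insert.hyps(2) insert.prems, of s]
  have "finite (SIGMA C:?Cs. labelled_partitions (S - C) I s)"
    using finC IH(1) by blast
  then have fin: "finite (labelled_partitions S (insert a I) s)"
    using bij_betw_finite[OF bij] by simp
  moreover have "card (labelled_partitions S (insert a I) s) * (\<Prod>b\<in>insert a I. fact (s b)) = fact (card S)"
    if sum: "(\<Sum>b\<in>insert a I. s b) = card S"
  proof -
    have s: "s a + (\<Sum>b\<in>I. s b) = card S" using sum insert.hyps by simp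
    have "card (labelled_partitions S (insert a I) s) = (\<Sum>C\<in>?Cs. card (labelled_partitions (S - C) I s))"
      using bij_betw_same_card[OF bij] finC IH(1) by (simp add: card_SigmaI)
    then have "card (labelled_partitions S (insert a I) s) * (\<Prod>b\<in>I. fact (s b))
        = (\<Sum>C\<in>?Cs. card (labelled_partitions (S - C) I s) * (\<Prod>b\<in>I. fact (s b)))"
      by (simp add: sum_distrib_right)
    also have "\<dots> = (\<Sum>C\<in>?Cs. fact (card S - s a))"
    proof (intro sum.cong refl)
      fix C assume "C \<in> ?Cs"
      then have "card (S - C) = card S - s a"
        using insert.prems by (auto simp: card_Diff_subset finite_subset)
      then show "card (labelled_partitions (S - C) I s) * (\<Prod>b\<in>I. fact (s b)) = fact (card S - s a)"
        using IH(2)[of C] s by simp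
    qed
    also have "\<dots> = (card S choose s a) * fact (card S - s a)"
      using insert.prems by (simp add: n_subsets)
    finally have "card (labelled_partitions S (insert a I) s) * (\<Prod>b\<in>I. fact (s b)) * fact (s a)
        = fact (s a) * fact (card S - s a) * (card S choose s a)"
      by simp
    also have "\<dots> = fact (card S)"
      using s by (intro binomial_fact_lemma) simp
    finally show ?thesis using insert.hyps by (simp add: ac_simps)
  qed
  ultimately show ?case by blast
qed

lemma finite_ordered_partitions: "finite I \<Longrightarrow> finite (ordered_partitions n I s)"
  using finite_card_labelled_partitions by (auto simp: ordered_partitions_eq)

lemma card_ordered_partitions:
  assumes "finite I" "(\<Sum>a\<in>I. s a) = n"
  shows "real (card (ordered_partitions n I s)) = fact n / (\<Prod>a\<in>I. fact (s a))"
proof -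
  have "card (ordered_partitions n I s) * (\<Prod>a\<in>I. fact (s a)) = (fact n :: nat)"
    using finite_card_labelled_partitions[of I "{1..n}" s] assms by (simp add: ordered_partitions_eq)
  then have "real (card (ordered_partitions n I s) * (\<Prod>a\<in>I. fact (s a))) = real (fact n)"
    by (rule arg_cong)
  then have "real (card (ordered_partitions n I s)) * (\<Prod>a\<in>I. fact (s a)) = fact n"
    by simp
  moreover have "(\<Prod>a\<in>I. fact (s a)) \<noteq> (0::real)"
    using assms(1) by simp
  ultimately show ?thesis by (simp add: field_simps)
qed

lemma ordered_partitions_nonempty:
  assumes "finite I" "(\<Sum>a\<in>I. s a) = n"
  shows "ordered_partitions n I s \<noteq> {}"
proof
  assume "ordered_partitions n I s = {}"
  then show False using card_ordered_partitions[OF assms] assms(1) by simp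
qed

text \<open>The cells determine both partitions, since the classes of the opposite side cover
  everything. Conversely, unions of cells along rows and columns have the sizes \<open>s\<close> and
  \<open>t\<close> because these are the margins of \<open>r\<close>.\<close>

lemma bij_betw_common_refinement:
  assumes fin: "finite I" "finite J" and r: "r \<in> overlap_matrices I J s t"
  shows "bij_betw (\<lambda>(V, W). \<lambda>(a, b). V a \<inter> W b)
    {(V, W). V \<in> ordered_partitions n I s \<and> W \<in> ordered_partitions n J t \<and> overlap V W = r}
    (ordered_partitions n (I \<times> J) (\<lambda>(a, b). r a b))"
    (is "bij_betw _ ?A ?B")
proof (rule bij_betw_byWitness[where f' = "\<lambda>U. (\<lambda>a. \<Union>b\<in>J. U (a, b), \<lambda>b. \<Union>a\<in>I. U (a, b))"])
  show "\<forall>p\<in>?A. (\<lambda>U. (\<lambda>a. \<Union>b\<in>J. U (a, b), \<lambda>b. \<Union>a\<in>I. U (a, b)))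
      ((\<lambda>(V, W). \<lambda>(a, b). V a \<inter> W b) p) = p"
  proof
    fix p assume "p \<in> ?A"
    then obtain V W where p: "p = (V, W)"
      and V: "V \<in> ordered_partitions n I s" and W: "W \<in> ordered_partitions n J t" by blast
    have "(\<Union>b\<in>J. V a \<inter> W b) = V a" for a
    proof -
      have "(\<Union>b\<in>J. V a \<inter> W b) = V a \<inter> {1..n}"
        using W by (simp add: ordered_partitions_def flip: Int_UN_distrib)
      then show ?thesis using ordered_partitions_subset[OF V] by blast
    qed
    moreover have "(\<Union>a\<in>I. V a \<inter> W b) = W b" for b
    proof -
      have "(\<Union>a\<in>I. V a \<inter> W b) = {1..n} \<inter> W b"
        using V by (simp add: ordered_partitions_def flip: Int_UN_distrib2)
      then show ?thesis using ordered_partitions_subset[OF W] by blast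
    qed
    ultimately show "(\<lambda>U. (\<lambda>a. \<Union>b\<in>J. U (a, b), \<lambda>b. \<Union>a\<in>I. U (a, b)))
        ((\<lambda>(V, W). \<lambda>(a, b). V a \<inter> W b) p) = p"
      by (simp add: p)
  qed
  show "\<forall>U\<in>?B. (\<lambda>(V, W). \<lambda>(a, b). V a \<inter> W b) (\<lambda>a. \<Union>b\<in>J. U (a, b), \<lambda>b. \<Union>a\<in>I. U (a, b)) = U"
  proof
    fix U assume U: "U \<in> ?B"
    have emp: "U p = {}" if "p \<notin> I \<times> J" for p
      using U that unfolding ordered_partitions_def by blast
    have disj: "p = q" if "p \<in> I \<times> J" "q \<in> I \<times> J" "x \<in> U p" "x \<in> U q" for p q x
      using ordered_partitions_disjoint[OF U that(1,2)] that(3,4) by blast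
    have "(\<Union>b\<in>J. U (a, b)) \<inter> (\<Union>a\<in>I. U (a, b)) = U (a, b)" for a b
    proof (intro equalityI subsetI)
      fix x assume "x \<in> (\<Union>b\<in>J. U (a, b)) \<inter> (\<Union>a\<in>I. U (a, b))"
      then obtain a' b' where x: "b' \<in> J" "a' \<in> I" "x \<in> U (a, b')" "x \<in> U (a', b)" by blast
      then have "(a, b') \<in> I \<times> J" "(a', b) \<in> I \<times> J" using emp by blast+
      then have "(a, b') = (a', b)" using disj x by blast
      then show "x \<in> U (a, b)" using x by simp
    next
      fix x assume x: "x \<in> U (a, b)"
      then have "(a, b) \<in> I \<times> J" using emp by blast
      then show "x \<in> (\<Union>b\<in>J. U (a, b)) \<inter> (\<Union>a\<in>I. U (a, b))" using x by blast
    qed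
    then show "(\<lambda>(V, W). \<lambda>(a, b). V a \<inter> W b) (\<lambda>a. \<Union>b\<in>J. U (a, b), \<lambda>b. \<Union>a\<in>I. U (a, b)) = U"
      by (simp add: fun_eq_iff)
  qed
  show "(\<lambda>(V, W). \<lambda>(a, b). V a \<inter> W b) ` ?A \<subseteq> ?B"
  proof clarify
    fix V W assume V: "V \<in> ordered_partitions n I s" and W: "W \<in> ordered_partitions n J t"
      and "r = overlap V W"
    let ?U = "\<lambda>(a, b). V a \<inter> W b"
    have "?U p \<inter> ?U q = {}" if "p \<in> I \<times> J" "q \<in> I \<times> J" "p \<noteq> q" for p q
    proof -
      have "V (fst p) \<inter> V (fst q) = {} \<or> W (snd p) \<inter> W (snd q) = {}"
        using that ordered_partitions_disjoint[OF V] ordered_partitions_disjoint[OF W]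
        by (metis mem_Times_iff prod_eq_iff)
      then show ?thesis by (auto simp: case_prod_beta)
    qed
    then have "disjoint_family_on ?U (I \<times> J)" unfolding disjoint_family_on_def by blast
    moreover have "?U p = {}" if "p \<notin> I \<times> J" for p
      using that V W by (cases p) (auto simp: ordered_partitions_def)
    moreover have "(\<Union>p\<in>I \<times> J. ?U p) = {1..n}"
    proof -
      have "(\<Union>p\<in>I \<times> J. ?U p) = (\<Union>a\<in>I. V a) \<inter> (\<Union>b\<in>J. W b)" by force
      then show ?thesis using V W by (simp add: ordered_partitions_def)
    qed
    ultimately show "?U \<in> ordered_partitions n (I \<times> J) (\<lambda>(a, b). overlap V W a b)"
      unfolding ordered_partitions_def overlap_def by auto
  qed
  show "(\<lambda>U. (\<lambda>a. \<Union>b\<in>J. U (a, b), \<lambda>b. \<Union>a\<in>I. U (a, b))) ` ?B \<subseteq> ?A"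
  proof (intro image_subsetI)
    fix U assume U: "U \<in> ?B"
    let ?V = "\<lambda>a. \<Union>b\<in>J. U (a, b)" and ?W = "\<lambda>b. \<Union>a\<in>I. U (a, b)"
    have emp: "U p = {}" if "p \<notin> I \<times> J" for p
      using U that unfolding ordered_partitions_def by blast
    have cardU: "card (U (a, b)) = r a b" if "a \<in> I" "b \<in> J" for a b
      using U that by (auto simp: ordered_partitions_def)
    have finU: "finite (U p)" for p by (rule ordered_partitions_finite_class[OF U])
    have disj: "p = q" if "p \<in> I \<times> J" "q \<in> I \<times> J" "x \<in> U p" "x \<in> U q" for p q x
      using ordered_partitions_disjoint[OF U that(1,2)] that(3,4) by blast
    have un: "(\<Union>p\<in>I \<times> J. U p) = {1..n}" using U by (simp add: ordered_partitions_def)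
    have cV: "card (?V a) = s a" if "a \<in> I" for a
    proof -
      have "card (?V a) = (\<Sum>b\<in>J. card (U (a, b)))"
        using fin finU disj that by (intro card_UN_disjoint) auto
      also have "\<dots> = s a" using r that by (simp add: cardU overlap_matrices_def)
      finally show ?thesis .
    qed
    have cW: "card (?W b) = t b" if "b \<in> J" for b
    proof -
      have "card (?W b) = (\<Sum>a\<in>I. card (U (a, b)))"
        using fin finU disj that by (intro card_UN_disjoint) auto
      also have "\<dots> = t b" using r that by (simp add: cardU overlap_matrices_def)
      finally show ?thesis .
    qed
    have VW: "?V a \<inter> ?W b = U (a, b)" for a b
    proof (intro equalityI subsetI)
      fix x assume "x \<in> ?V a \<inter> ?W b"
      then obtain a' b' where x: "b' \<in> J" "a' \<in> I" "x \<in> U (a, b')" "x \<in> U (a', b)" by blast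
      then have "(a, b') \<in> I \<times> J" "(a', b) \<in> I \<times> J" using emp by blast+
      then have "(a, b') = (a', b)" using disj x by blast
      then show "x \<in> U (a, b)" using x by simp
    next
      fix x assume x: "x \<in> U (a, b)"
      then have "(a, b) \<in> I \<times> J" using emp by blast
      then show "x \<in> ?V a \<inter> ?W b" using x by blast
    qed
    have "?V a = {}" if "a \<notin> I" for a using emp that by simp
    moreover have "disjoint_family_on ?V I"
      unfolding disjoint_family_on_def
    proof (intro ballI impI)
      fix a a' assume "a \<in> I" "a' \<in> I" "a \<noteq> a'"
      then show "?V a \<inter> ?V a' = {}" using disj by blast
    qed
    moreover have "(\<Union>a\<in>I. ?V a) = {1..n}" unfolding un[symmetric] by blast
    ultimately have V: "?V \<in> ordered_partitions n I s"
      using cV by (simp add: ordered_partitions_def)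
    have "?W b = {}" if "b \<notin> J" for b using emp that by simp
    moreover have "disjoint_family_on ?W J"
      unfolding disjoint_family_on_def
    proof (intro ballI impI)
      fix b b' assume "b \<in> J" "b' \<in> J" "b \<noteq> b'"
      then show "?W b \<inter> ?W b' = {}" using disj by blast
    qed
    moreover have "(\<Union>b\<in>J. ?W b) = {1..n}" unfolding un[symmetric] by blast
    ultimately have W: "?W \<in> ordered_partitions n J t"
      using cW by (simp add: ordered_partitions_def)
    have "overlap ?V ?W a b = r a b" for a b
    proof (cases "a \<in> I \<and> b \<in> J")
      case True
      then show ?thesis unfolding overlap_def VW using cardU by blast
    next
      case False
      then have "r a b = 0" using r by (auto simp: overlap_matrices_def)
      moreover have "U (a, b) = {}" using False emp by blast
      ultimately show ?thesis unfolding overlap_def VW by simp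
    qed
    then have "overlap ?V ?W = r" by (intro ext)
    then show "(?V, ?W) \<in> ?A" using V W by blast
  qed
qed

section \<open>The law of the overlap matrix\<close>

lemma card_pairs_with_overlap:
  assumes fin: "finite I" "finite J" and r: "r \<in> overlap_matrices I J s t"
    and n: "(\<Sum>a\<in>I. s a) = n"
  shows "real (card {(V, W). V \<in> ordered_partitions n I s \<and> W \<in> ordered_partitions n J t \<and> overlap V W = r})
    = fact n / (\<Prod>a\<in>I. \<Prod>b\<in>J. fact (r a b))"
proof -
  have "(\<Sum>(a, b)\<in>I \<times> J. r a b) = n"
    using r n by (simp add: overlap_matrices_def flip: sum.cartesian_product)
  then show ?thesis
    using bij_betw_same_card[OF bij_betw_common_refinement[OF fin r, of n]]
      card_ordered_partitions[of "I \<times> J" "\<lambda>(a, b). r a b" n] fin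
    by (simp add: prod.cartesian_product case_prod_beta)
qed

lemma overlap_in_overlap_matrices:
  assumes V: "V \<in> ordered_partitions n I s" and W: "W \<in> ordered_partitions n J t"
    and fin: "finite I" "finite J"
  shows "overlap V W \<in> overlap_matrices I J s t"
proof -
  have "overlap V W a b = 0" if "a \<notin> I \<or> b \<notin> J" for a b
    using that V W by (auto simp: overlap_def ordered_partitions_def)
  moreover have "(\<Sum>b\<in>J. overlap V W a b) = s a" if "a \<in> I" for a
  proof -
    have "(\<Sum>b\<in>J. overlap V W a b) = card (\<Union>b\<in>J. V a \<inter> W b)"
      unfolding overlap_def
      using fin ordered_partitions_finite_class[OF V] ordered_partitions_disjoint[OF W]
      by (intro card_UN_disjoint[symmetric]) blast+
    also have "(\<Union>b\<in>J. V a \<inter> W b) = V a"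
      using W ordered_partitions_subset[OF V] by (auto simp: ordered_partitions_def simp flip: Int_UN_distrib)
    finally show ?thesis using V that by (simp add: ordered_partitions_def)
  qed
  moreover have "(\<Sum>a\<in>I. overlap V W a b) = t b" if "b \<in> J" for b
  proof -
    have "(\<Sum>a\<in>I. overlap V W a b) = card (\<Union>a\<in>I. V a \<inter> W b)"
      unfolding overlap_def
      using fin ordered_partitions_finite_class[OF V] ordered_partitions_disjoint[OF V]
      by (intro card_UN_disjoint[symmetric]) blast+
    also have "(\<Union>a\<in>I. V a \<inter> W b) = W b"
      using V ordered_partitions_subset[OF W] by (auto simp: ordered_partitions_def simp flip: Int_UN_distrib2)
    finally show ?thesis using W that by (simp add: ordered_partitions_def)
  qed
  ultimately show ?thesis by (simp add: overlap_matrices_def)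
qed

text \<open>The product of two uniform laws is uniform on the product set, so point probabilities
  are quotients of counts.\<close>

lemma pmf_overlap_law:
  assumes fin: "finite I" "finite J" and n: "(\<Sum>a\<in>I. s a) = n" "(\<Sum>b\<in>J. t b) = n"
  shows "pmf (overlap_law n I J s t) r
    = real (card {(V, W). V \<in> ordered_partitions n I s \<and> W \<in> ordered_partitions n J t \<and> overlap V W = r})
      / (real (card (ordered_partitions n I s)) * real (card (ordered_partitions n J t)))"
proof -
  let ?A = "ordered_partitions n I s" and ?B = "ordered_partitions n J t"
  have ne: "?A \<noteq> {}" "?B \<noteq> {}" and f: "finite ?A" "finite ?B"
    using fin n by (auto simp: ordered_partitions_nonempty finite_ordered_partitions)
  have "pair_pmf (pmf_of_set ?A) (pmf_of_set ?B) = pmf_of_set (?A \<times> ?B)"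
  proof (rule pmf_eqI)
    show "pmf (pair_pmf (pmf_of_set ?A) (pmf_of_set ?B)) p = pmf (pmf_of_set (?A \<times> ?B)) p" for p
      by (cases p) (simp add: pmf_pair ne f indicator_def card_cartesian_product)
  qed
  then have "pmf (overlap_law n I J s t) r
      = measure_pmf.prob (pmf_of_set (?A \<times> ?B)) ((\<lambda>(V, W). overlap V W) -` {r})"
    by (simp add: overlap_law_def pmf_map)
  also have "\<dots> = real (card ((?A \<times> ?B) \<inter> (\<lambda>(V, W). overlap V W) -` {r})) / real (card (?A \<times> ?B))"
    using ne f by (intro measure_pmf_of_set) auto
  also have "(?A \<times> ?B) \<inter> (\<lambda>(V, W). overlap V W) -` {r}
      = {(V, W). V \<in> ?A \<and> W \<in> ?B \<and> overlap V W = r}"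
    by auto
  finally show ?thesis by (simp add: card_cartesian_product)
qed

section \<open>Ordered and unordered partitions\<close>

text \<open>The condition ranges over all \<open>u\<close>, so a size that no slot has cannot occur
  among the classes.\<close>

definition typed_partitions :: "nat \<Rightarrow> 'a set \<Rightarrow> ('a \<Rightarrow> nat) \<Rightarrow> nat set set set" where
  "typed_partitions n I s =
     {P. partition_on {1..n} P \<and> (\<forall>u. card {C \<in> P. card C = u} = card {a \<in> I. s a = u})}"

text \<open>Two slots with the same class would have that class disjoint from itself, hence empty,
  which positive sizes exclude.\<close>

lemma ordered_partitions_inj_on:
  assumes V: "V \<in> ordered_partitions n I s" and pos: "\<And>a. a \<in> I \<Longrightarrow> 0 < s a"
  shows "inj_on V I"
proof (rule inj_onI, rule ccontr)
  fix a a' assume a: "a \<in> I" "a' \<in> I" "V a = V a'" "a \<noteq> a'"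
  then have "V a = {}" using ordered_partitions_disjoint[OF V] by blast
  moreover have "card (V a) = s a" using V a(1) unfolding ordered_partitions_def by blast
  ultimately show False using pos[of a] a by simp
qed

lemma ordered_partitions_image:
  assumes V: "V \<in> ordered_partitions n I s" and pos: "\<And>a. a \<in> I \<Longrightarrow> 0 < s a"
  shows "V ` I \<in> typed_partitions n I s"
proof -
  have cV: "card (V a) = s a" if "a \<in> I" for a
    using V that by (simp add: ordered_partitions_def)
  have inj: "inj_on V I" using ordered_partitions_inj_on[OF V pos] .
  have "partition_on {1..n} (V ` I)"
  proof (rule partition_onI)
    show "\<Union> (V ` I) = {1..n}" using V by (simp add: ordered_partitions_def)
    show "disjnt p q" if "p \<in> V ` I" "q \<in> V ` I" "p \<noteq> q" for p q
      using that ordered_partitions_disjoint[OF V] unfolding disjnt_def by blast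
    show "{} \<notin> V ` I"
    proof
      assume "{} \<in> V ` I"
      then obtain a where "a \<in> I" "V a = {}" by auto
      then show False using cV[of a] pos[of a] by simp
    qed
  qed
  moreover have "card {C \<in> V ` I. card C = u} = card {a \<in> I. s a = u}" for u
  proof -
    have "{C \<in> V ` I. card C = u} = V ` {a \<in> I. s a = u}" using cV by auto
    then show ?thesis using inj by (simp add: card_image inj_on_subset)
  qed
  ultimately show ?thesis by (simp add: typed_partitions_def)
qed

text \<open>For each size choose a bijection between the slots and the classes of that size, and
  glue these together.\<close>

lemma typed_partition_enumeration:
  assumes P: "P \<in> typed_partitions n I s" and I: "finite I"
  shows "\<exists>V. V \<in> ordered_partitions n I s \<and> V ` I = P"
proof -
  have part: "partition_on {1..n} P" using P by (simp add: typed_partitions_def)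
  have finP: "finite P" using part by (rule finite_elements[rotated]) simp
  have "\<exists>g. bij_betw g {a \<in> I. s a = u} {C \<in> P. card C = u}" for u
    using P I finP by (intro finite_same_card_bij) (auto simp: typed_partitions_def)
  then obtain g where g: "\<And>u. bij_betw (g u) {a \<in> I. s a = u} {C \<in> P. card C = u}" by metis
  define V where "V a = (if a \<in> I then g (s a) a else {})" for a
  have VP: "V a \<in> P \<and> card (V a) = s a" if "a \<in> I" for a
    using bij_betw_apply[OF g[of "s a"], of a] that by (simp add: V_def)
  have inj: "a = a'" if "a \<in> I" "a' \<in> I" "V a = V a'" for a a'
  proof -
    have "s a = s a'" using VP that by metis
    then show ?thesis
      using that bij_betw_imp_inj_on[OF g[of "s a"]] by (auto simp: V_def inj_on_def)
  qed
  have im: "V ` I = P"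
  proof (intro equalityI subsetI)
    fix C assume "C \<in> P"
    then have "C \<in> g (card C) ` {a \<in> I. s a = card C}"
      using bij_betw_imp_surj_on[OF g[of "card C"]] by simp
    then obtain a where a: "a \<in> I" "s a = card C" "g (card C) a = C" by blast
    then have "V a = C" by (simp add: V_def)
    then show "C \<in> V ` I" using a(1) by blast
  qed (use VP in auto)
  have "disjoint_family_on V I"
    unfolding disjoint_family_on_def
  proof (intro ballI impI)
    fix a a' assume a: "a \<in> I" "a' \<in> I" "a \<noteq> a'"
    then have "V a \<noteq> V a'" using inj by blast
    then show "V a \<inter> V a' = {}"
      using disjointD[OF partition_onD2[OF part]] VP a by blast
  qed
  moreover have "(\<Union>a\<in>I. V a) = {1..n}"
    using partition_onD1[OF part] im by simp
  ultimately have "V \<in> ordered_partitions n I s"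
    using VP unfolding ordered_partitions_def by (auto simp: V_def)
  then show ?thesis using im by blast
qed

definition signed_typed_partitions :: "nat \<Rightarrow> 'a set \<Rightarrow> ('a \<Rightarrow> nat) \<Rightarrow> (nat set set \<times> (nat set \<Rightarrow> class_decl)) set" where
  "signed_typed_partitions n I s = {(P, D). P \<in> typed_partitions n I s \<and> D \<in> P \<rightarrow>\<^sub>E UNIV}"

text \<open>The stabilizer of \<open>s\<close> in the symmetric group on \<open>I\<close>. For
  positive sizes it acts simply transitively on the orderings of a given typed partition.\<close>

definition size_perms :: "'a set \<Rightarrow> ('a \<Rightarrow> nat) \<Rightarrow> ('a \<Rightarrow> 'a) set" where
  "size_perms I s = {\<pi>. \<pi> permutes I \<and> (\<forall>a\<in>I. s (\<pi> a) = s a)}"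

definition enumeration :: "nat \<Rightarrow> 'a set \<Rightarrow> ('a \<Rightarrow> nat) \<Rightarrow> nat set set \<Rightarrow> 'a \<Rightarrow> nat set" where
  "enumeration n I s P = (SOME V. V \<in> ordered_partitions n I s \<and> V ` I = P)"

text \<open>The chosen enumeration of \<open>P\<close> serves as base point, and composition with
  permutations reaches the other orderings. The declarations are carried from classes to slots at
  the same time.\<close>

definition ordered_of_unordered ::
  "nat \<Rightarrow> 'a set \<Rightarrow> ('a \<Rightarrow> nat) \<Rightarrow> (nat set set \<times> (nat set \<Rightarrow> class_decl)) \<times> ('a \<Rightarrow> 'a)
    \<Rightarrow> ('a \<Rightarrow> nat set) \<times> ('a \<Rightarrow> class_decl)" where
  "ordered_of_unordered n I s = (\<lambda>((P, D), \<pi>).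
     (\<lambda>a. enumeration n I s P (\<pi> a), \<lambda>a\<in>I. D (enumeration n I s P (\<pi> a))))"

lemma enumeration:
  assumes "P \<in> typed_partitions n I s" "finite I"
  shows "enumeration n I s P \<in> ordered_partitions n I s" "enumeration n I s P ` I = P"
  using someI_ex[OF typed_partition_enumeration[OF assms]] unfolding enumeration_def by blast+

lemma enumeration_comp:
  assumes P: "P \<in> typed_partitions n I s" and I: "finite I" and \<pi>: "\<pi> \<in> size_perms I s"
  shows "(\<lambda>a. enumeration n I s P (\<pi> a)) \<in> ordered_partitions n I s"
    and "(\<lambda>a. enumeration n I s P (\<pi> a)) ` I = P"
proof -
  let ?E = "enumeration n I s P"
  note E = enumeration[OF P I]
  have perm: "\<pi> permutes I" and size: "\<And>a. a \<in> I \<Longrightarrow> s (\<pi> a) = s a"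
    using \<pi> by (auto simp: size_perms_def)
  have "(\<lambda>a. ?E (\<pi> a)) ` I = ?E ` (\<pi> ` I)" by auto
  then show im: "(\<lambda>a. ?E (\<pi> a)) ` I = P" using permutes_image[OF perm] E(2) by simp
  have "?E (\<pi> a) \<inter> ?E (\<pi> a') = {}" if "a \<in> I" "a' \<in> I" "a \<noteq> a'" for a a'
    using that ordered_partitions_disjoint[OF E(1), of "\<pi> a" "\<pi> a'"] permutes_in_image[OF perm]
      permutes_inj[OF perm] by (simp add: inj_eq)
  moreover have "(\<Union>a\<in>I. ?E (\<pi> a)) = {1..n}"
    using im E by (simp add: ordered_partitions_def)
  ultimately show "(\<lambda>a. ?E (\<pi> a)) \<in> ordered_partitions n I s"
    using E(1) size permutes_in_image[OF perm]
    unfolding ordered_partitions_def disjoint_family_on_def by simp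
qed

text \<open>Positive sizes make every ordering injective. This recovers the permutation from the
  reordered classes, and the declaration of a class from that of its slot.\<close>

lemma bij_betw_ordered_of_unordered:
  assumes I: "finite I" and pos: "\<And>a. a \<in> I \<Longrightarrow> 0 < s a"
  shows "bij_betw (ordered_of_unordered n I s)
    (signed_typed_partitions n I s \<times> size_perms I s)
    (ordered_partitions n I s \<times> (I \<rightarrow>\<^sub>E UNIV))"
    (is "bij_betw _ ?A ?B")
proof (rule bij_betw_imageI)
  show "inj_on (ordered_of_unordered n I s) ?A"
  proof (rule inj_onI)
    fix x y assume xy: "x \<in> ?A" "y \<in> ?A" and eq: "ordered_of_unordered n I s x = ordered_of_unordered n I s y"
    obtain P D \<pi> where x: "x = ((P, D), \<pi>)" by (metis surj_pair)
    obtain P' D' \<pi>' where y: "y = ((P', D'), \<pi>')" by (metis surj_pair)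
    have P: "P \<in> typed_partitions n I s" "P' \<in> typed_partitions n I s"
      and D: "D \<in> P \<rightarrow>\<^sub>E UNIV" "D' \<in> P' \<rightarrow>\<^sub>E UNIV"
      and \<pi>: "\<pi> \<in> size_perms I s" "\<pi>' \<in> size_perms I s"
      using xy x y by (auto simp: signed_typed_partitions_def)
    have eV: "(\<lambda>a. enumeration n I s P (\<pi> a)) = (\<lambda>a. enumeration n I s P' (\<pi>' a))"
      and eD: "(\<lambda>a\<in>I. D (enumeration n I s P (\<pi> a))) = (\<lambda>a\<in>I. D' (enumeration n I s P' (\<pi>' a)))"
      using eq by (simp_all add: ordered_of_unordered_def x y)
    have "P' = (\<lambda>a. enumeration n I s P' (\<pi>' a)) ` I"
      by (rule enumeration_comp(2)[OF P(2) I \<pi>(2), symmetric])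
    also have "\<dots> = P"
      unfolding eV[symmetric] by (rule enumeration_comp(2)[OF P(1) I \<pi>(1)])
    finally have PP: "P' = P" .
    have inj: "inj_on (enumeration n I s P) I"
      using ordered_partitions_inj_on[OF enumeration(1)[OF P(1) I] pos] .
    have perm: "\<pi> permutes I" "\<pi>' permutes I" using \<pi> by (auto simp: size_perms_def)
    have "\<pi> a = \<pi>' a" for a
    proof (cases "a \<in> I")
      case True
      then have "\<pi> a \<in> I" "\<pi>' a \<in> I" using perm by (simp_all add: permutes_in_image)
      then show ?thesis using inj fun_cong[OF eV, of a] by (simp add: PP inj_on_eq_iff)
    qed (use perm in \<open>simp add: permutes_not_in\<close>)
    then have pp: "\<pi>' = \<pi>" by (simp add: fun_eq_iff)
    have "D = D'"
    proof (rule PiE_ext[OF D(1)])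
      show "D' \<in> P \<rightarrow>\<^sub>E UNIV" using D(2) PP by simp
      fix C assume "C \<in> P"
      then obtain a where a: "a \<in> I" "C = enumeration n I s P (\<pi> a)"
        using enumeration_comp(2)[OF P(1) I \<pi>(1)] by blast
      then show "D C = D' C" using fun_cong[OF eD, of a] by (simp add: PP pp)
    qed
    then show "x = y" by (simp add: x y PP pp)
  qed
  show "ordered_of_unordered n I s ` ?A = ?B"
  proof (intro equalityI subsetI)
    fix z assume "z \<in> ordered_of_unordered n I s ` ?A"
    then obtain P D \<pi> where z: "z = ordered_of_unordered n I s ((P, D), \<pi>)"
      and P: "P \<in> typed_partitions n I s" and \<pi>: "\<pi> \<in> size_perms I s"
      by (auto simp: signed_typed_partitions_def)
    show "z \<in> ?B"
      using enumeration_comp(1)[OF P I \<pi>] by (simp add: z ordered_of_unordered_def)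
  next
    fix z assume "z \<in> ?B"
    then obtain V \<sigma> where z: "z = (V, \<sigma>)" and V: "V \<in> ordered_partitions n I s"
      and \<sigma>: "\<sigma> \<in> I \<rightarrow>\<^sub>E UNIV" by auto
    define P where "P = V ` I"
    define D where "D = (\<lambda>C\<in>P. \<sigma> (inv_into I V C))"
    let ?E = "enumeration n I s P"
    \<comment> \<open>The relabelling of slots that carries the base ordering to
      \<open>V\<close>.\<close>
    define \<pi> where "\<pi> a = (if a \<in> I then inv_into I ?E (V a) else a)" for a
    have P: "P \<in> typed_partitions n I s"
      unfolding P_def by (rule ordered_partitions_image[OF V pos])
    note E = enumeration[OF P I]
    have injV: "inj_on V I" by (rule ordered_partitions_inj_on[OF V pos])
    have injE: "inj_on ?E I" by (rule ordered_partitions_inj_on[OF E(1) pos])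
    have "bij_betw (inv_into I ?E) P I"
      using bij_betw_inv_into[OF bij_betw_imageI[OF injE E(2)]] .
    then have "bij_betw (inv_into I ?E \<circ> V) I I"
      using injV by (intro bij_betw_trans[of V I P]) (auto simp: bij_betw_def P_def)
    then have "bij_betw \<pi> I I"
      by (rule bij_betw_cong[THEN iffD1, rotated]) (simp add: \<pi>_def)
    then have perm: "\<pi> permutes I"
      by (rule bij_imp_permutes) (simp add: \<pi>_def)
    have E\<pi>: "?E (\<pi> a) = V a" for a
    proof (cases "a \<in> I")
      case True
      then have "V a \<in> ?E ` I" using E(2) by (simp add: P_def)
      then show ?thesis using True by (simp add: \<pi>_def f_inv_into_f)
    next
      case False
      then show ?thesis using V E(1) by (simp add: \<pi>_def ordered_partitions_def)
    qed
    have "s (\<pi> a) = s a" if "a \<in> I" for a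
    proof -
      have "\<pi> a \<in> I" using that perm by (simp add: permutes_in_image)
      then have "s (\<pi> a) = card (?E (\<pi> a))" using E(1) by (simp add: ordered_partitions_def)
      also have "\<dots> = s a" using V that by (simp add: E\<pi> ordered_partitions_def)
      finally show ?thesis .
    qed
    then have "\<pi> \<in> size_perms I s" using perm by (simp add: size_perms_def)
    moreover have "D \<in> P \<rightarrow>\<^sub>E UNIV" by (simp add: D_def)
    moreover have "(\<lambda>a\<in>I. D (V a)) = \<sigma>"
      using \<sigma> injV by (auto simp: fun_eq_iff D_def P_def PiE_def extensional_def)
    ultimately have "((P, D), \<pi>) \<in> ?A" "ordered_of_unordered n I s ((P, D), \<pi>) = z"
      using P by (simp_all add: signed_typed_partitions_def ordered_of_unordered_def E\<pi> z)
    then show "z \<in> ordered_of_unordered n I s ` ?A" by (metis image_eqI)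
  qed
qed

lemma finite_size_perms: "finite I \<Longrightarrow> finite (size_perms I s)"
  unfolding size_perms_def by (rule finite_subset[OF _ finite_permutations[of I]]) auto

lemma id_in_size_perms: "id \<in> size_perms I s"
  by (simp add: size_perms_def permutes_id)

text \<open>Read off from the bijection: the product with \<open>size_perms I s\<close> is finite,
  and that factor contains \<open>id\<close>, so the other factor is finite.\<close>

lemma finite_signed_typed_partitions:
  assumes I: "finite I" and pos: "\<And>a. a \<in> I \<Longrightarrow> 0 < s a"
  shows "finite (signed_typed_partitions n I s)"
proof -
  have "finite (ordered_partitions n I s \<times> (I \<rightarrow>\<^sub>E (UNIV :: class_decl set)))"
    using I by (simp add: finite_ordered_partitions finite_PiE)
  then have "finite (signed_typed_partitions n I s \<times> size_perms I s)"
    using bij_betw_finite[OF bij_betw_ordered_of_unordered[OF I pos]] by simp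
  then show ?thesis
    using id_in_size_perms[of I s] by (auto dest: finite_cartesian_productD1)
qed

text \<open>The proportionality holds for every single graph, so it transfers to all moments of the
  two counts.\<close>

lemma ordered_signed_count:
  assumes I: "finite I" and pos: "\<And>a. a \<in> I \<Longrightarrow> 0 < s a"
  shows "(\<Sum>(V, \<sigma>)\<in>ordered_partitions n I s \<times> (I \<rightarrow>\<^sub>E UNIV). of_bool (\<forall>a\<in>I. realizes G (\<sigma> a) (V a)))
    = real (card (size_perms I s))
      * real (card {(P, D) \<in> signed_typed_partitions n I s. \<forall>C\<in>P. realizes G (D C) C})"
proof -
  let ?S = "signed_typed_partitions n I s"
  let ?good = "\<lambda>(P, D). \<forall>C\<in>P. realizes G (D C) C"
  have "(\<Sum>(V, \<sigma>)\<in>ordered_partitions n I s \<times> (I \<rightarrow>\<^sub>E UNIV). of_bool (\<forall>a\<in>I. realizes G (\<sigma> a) (V a)) :: real)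
      = (\<Sum>x\<in>?S \<times> size_perms I s. case ordered_of_unordered n I s x of
          (V, \<sigma>) \<Rightarrow> of_bool (\<forall>a\<in>I. realizes G (\<sigma> a) (V a)))"
    by (rule sum.reindex_bij_betw[symmetric, OF bij_betw_ordered_of_unordered[OF I pos]])
  also have "\<dots> = (\<Sum>(x, \<pi>)\<in>?S \<times> size_perms I s. of_bool (?good x))"
  proof (intro sum.cong refl)
    fix x assume "x \<in> ?S \<times> size_perms I s"
    then obtain P D \<pi> where x: "x = ((P, D), \<pi>)"
      and P: "P \<in> typed_partitions n I s" and \<pi>: "\<pi> \<in> size_perms I s"
      by (auto simp: signed_typed_partitions_def)
    have "(\<forall>C\<in>P. realizes G (D C) C)
        \<longleftrightarrow> (\<forall>a\<in>I. realizes G (D (enumeration n I s P (\<pi> a))) (enumeration n I s P (\<pi> a)))"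
      by (subst enumeration_comp(2)[OF P I \<pi>, symmetric]) simp
    then show "(case ordered_of_unordered n I s x of
          (V, \<sigma>) \<Rightarrow> of_bool (\<forall>a\<in>I. realizes G (\<sigma> a) (V a)))
        = (case x of (x, \<pi>) \<Rightarrow> (of_bool (?good x) :: real))"
      by (simp add: x ordered_of_unordered_def)
  qed
  also have "\<dots> = (\<Sum>x\<in>?S. real (card (size_perms I s)) * of_bool (?good x))"
    by (simp add: sum.cartesian_product[symmetric])
  also have "\<dots> = real (card (size_perms I s)) * (\<Sum>x\<in>?S. of_bool (?good x))"
    by (simp add: sum_distrib_left)
  also have "(\<Sum>x\<in>?S. of_bool (?good x)) = real (card {x \<in> ?S. ?good x})"
    using finite_signed_typed_partitions[OF I pos] by (simp add: Int_def)
  also have "{x \<in> ?S. ?good x} = {(P, D) \<in> ?S. \<forall>C\<in>P. realizes G (D C) C}" by auto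
  finally show ?thesis .
qed

section \<open>The second moment\<close>

lemma expectation_sum_of_bool:
  fixes p :: "'a pmf"
  shows "measure_pmf.expectation p (\<lambda>x. \<Sum>y\<in>T. of_bool (Q y x)) = (\<Sum>y\<in>T. measure_pmf.prob p {x. Q y x})"
proof -
  have "integrable (measure_pmf p) (\<lambda>x. of_bool (Q y x) :: real)" for y
    by (rule measure_pmf.integrable_const_bound[where B = 1]) auto
  then have "measure_pmf.expectation p (\<lambda>x. \<Sum>y\<in>T. of_bool (Q y x))
      = (\<Sum>y\<in>T. measure_pmf.expectation p (\<lambda>x. of_bool (Q y x) :: real))"
    by (rule Bochner_Integration.integral_sum)
  also have "\<dots> = (\<Sum>y\<in>T. measure_pmf.expectation p (indicator {x. Q y x}))"
    by (intro sum.cong refl Bochner_Integration.integral_cong) (auto simp: indicator_def)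
  finally show ?thesis by simp
qed

context
  fixes n :: nat and I :: "'a set" and s :: "'a \<Rightarrow> nat"
  assumes fin: "finite I" and n: "(\<Sum>a\<in>I. s a) = n" and pos: "\<forall>a\<in>I. 0 < s a"
begin

abbreviation (input) "ordparts \<equiv> ordered_partitions n I s"
abbreviation (input) "decls \<equiv> I \<rightarrow>\<^sub>E (UNIV :: class_decl set)"
text \<open>The expected contribution of one ordered partition: the number of declaration maps times
  the probability that one of them is realized. Its square is the normalization in
  \<open>pair_local_factor\<close>.\<close>

abbreviation (input) "unit_weight \<equiv> 2 powi int (card I) * 2 powi (- int (\<Sum>a\<in>I. s a choose 2)) :: real"
abbreviation (input) "factor r \<equiv> 2 powi (int (overlap_weight I I r) + int (card (H_components r))
        - int (card (H_vertices r))) :: real"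
abbreviation (input) "ordered_count G \<equiv>
  (\<Sum>(V, \<sigma>)\<in>ordparts \<times> decls. of_bool (\<forall>a\<in>I. realizes G (\<sigma> a) (V a)) :: real)"

lemma card_decls: "card decls = 2 ^ card I"
  using fin by (simp add: card_PiE card_class_decl)

lemma expectation_ordered_count:
  "measure_pmf.expectation (random_graph n) ordered_count = real (card ordparts) * unit_weight"
proof -
  have "measure_pmf.expectation (random_graph n) ordered_count
      = (\<Sum>p\<in>ordparts \<times> decls. measure_pmf.prob (random_graph n)
          {G. \<forall>a\<in>I. realizes G (snd p a) (fst p a)})"
    by (simp only: case_prod_unfold expectation_sum_of_bool)
  also have "\<dots> = (\<Sum>p\<in>ordparts \<times> decls. 1 / 2 ^ (\<Sum>a\<in>I. s a choose 2))"
    by (intro sum.cong refl prob_realizes_one[OF _ fin]) auto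
  also have "\<dots> = real (card ordparts) * unit_weight"
    by (simp add: card_cartesian_product card_decls power_int_minus field_simps del: of_nat_sum)
  finally show ?thesis .
qed

lemma pair_local_factor_overlap:
  assumes V: "V \<in> ordparts" and W: "W \<in> ordparts"
  shows "pair_local_factor n (int (card I)) I I V W = factor (overlap V W)"
  by (rule pair_local_factor_eq[OF V W fin fin refl refl refl])
     (rule H_edges_subset[OF overlap_in_overlap_matrices[OF V W fin fin]])

text \<open>Expanding the square gives a sum over two ordered partitions with declarations. For
  fixed \<open>V\<close> and \<open>W\<close> the sum over both declaration maps is the numerator of
  \<open>pair_local_factor\<close>, whose closed form then applies.\<close>

lemma expectation_ordered_count_square:
  "measure_pmf.expectation (random_graph n) (\<lambda>G. (ordered_count G)\<^sup>2)
    = (\<Sum>V\<in>ordparts. \<Sum>W\<in>ordparts. factor (overlap V W)) * unit_weight\<^sup>2"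
proof -
  let ?T = "ordparts \<times> decls"
  let ?Q = "\<lambda>p q G. (\<forall>a\<in>I. realizes G (snd p a) (fst p a)) \<and> (\<forall>a\<in>I. realizes G (snd q a) (fst q a))"
  have u: "unit_weight\<^sup>2 \<noteq> 0" by simp
  have "(\<lambda>G. (ordered_count G)\<^sup>2) = (\<lambda>G. \<Sum>x\<in>?T \<times> ?T. of_bool (?Q (fst x) (snd x) G))"
    by (rule ext) (simp only: power2_eq_square sum_product sum.cartesian_product case_prod_unfold of_bool_conj)
  then have "measure_pmf.expectation (random_graph n) (\<lambda>G. (ordered_count G)\<^sup>2)
      = (\<Sum>x\<in>?T \<times> ?T. measure_pmf.prob (random_graph n) {G. ?Q (fst x) (snd x) G})"
    by (simp only: expectation_sum_of_bool)
  also have "\<dots> = (\<Sum>V\<in>ordparts. \<Sum>\<sigma>\<in>decls. \<Sum>W\<in>ordparts. \<Sum>\<tau>\<in>decls. measure_pmf.prob (random_graph n)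
      {G. (\<forall>a\<in>I. realizes G (\<sigma> a) (V a)) \<and> (\<forall>b\<in>I. realizes G (\<tau> b) (W b))})"
    by (simp only: sum.cartesian_product' fst_conv snd_conv)
  also have "\<dots> = (\<Sum>V\<in>ordparts. \<Sum>W\<in>ordparts. \<Sum>\<sigma>\<in>decls. \<Sum>\<tau>\<in>decls. measure_pmf.prob (random_graph n)
      {G. (\<forall>a\<in>I. realizes G (\<sigma> a) (V a)) \<and> (\<forall>b\<in>I. realizes G (\<tau> b) (W b))})"
    by (intro sum.cong refl sum.swap)
  also have "\<dots> = (\<Sum>V\<in>ordparts. \<Sum>W\<in>ordparts. factor (overlap V W) * unit_weight\<^sup>2)"
  proof (intro sum.cong refl)
    fix V W assume V: "V \<in> ordparts" and W: "W \<in> ordparts"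
    have "(\<Sum>a\<in>I. card (V a) choose 2) = (\<Sum>a\<in>I. s a choose 2)"
      using V by (intro sum.cong refl) (simp add: ordered_partitions_def)
    then show "(\<Sum>\<sigma>\<in>decls. \<Sum>\<tau>\<in>decls. measure_pmf.prob (random_graph n)
        {G. (\<forall>a\<in>I. realizes G (\<sigma> a) (V a)) \<and> (\<forall>b\<in>I. realizes G (\<tau> b) (W b))})
        = factor (overlap V W) * unit_weight\<^sup>2"
      using pair_local_factor_overlap[OF V W] u by (simp only: pair_local_factor_def) (simp add: field_simps)
  qed
  finally show ?thesis by (simp add: sum_distrib_right)
qed

text \<open>Existence by counting: the number of such pairs is a quotient of factorials, hence not
  zero. It guarantees that the choice in \<open>A_zeta\<close> succeeds.\<close>

lemma overlap_matrix_realized: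
  assumes r: "r \<in> overlap_matrices I I s s"
  shows "\<exists>V W. V \<in> ordparts \<and> W \<in> ordparts \<and> overlap V W = r"
proof (rule ccontr)
  assume "\<not> ?thesis"
  then have "{(V, W). V \<in> ordparts \<and> W \<in> ordparts \<and> overlap V W = r} = {}" by blast
  with card_pairs_with_overlap[OF fin fin r n] have "fact n / (\<Prod>a\<in>I. \<Prod>b\<in>I. fact (r a b)) = (0::real)"
    by (simp only: card.empty of_nat_0)
  then show False using fin by simp
qed

lemma A_zeta_factor:
  assumes r: "r \<in> overlap_matrices I I s s"
  shows "A_zeta n (int (card I)) I I s s r = factor r"
proof -
  let ?Q = "\<lambda>(V, W). V \<in> ordparts \<and> W \<in> ordparts \<and> overlap V W = r"
  obtain V W where VW: "(SOME p. ?Q p) = (V, W)" by (cases "SOME p. ?Q p")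
  have "\<exists>p. ?Q p" using overlap_matrix_realized[OF r] by simp
  then have "?Q (SOME p. ?Q p)" by (rule someI_ex)
  then have "V \<in> ordparts" "W \<in> ordparts" "overlap V W = r" by (simp_all add: VW)
  then show ?thesis
    unfolding A_zeta_def VW by (simp only: prod.case pair_local_factor_overlap)
qed

text \<open>Pairs of partitions are grouped by their overlap matrix. The image of the overlap map is
  the whole set of admissible matrices, which also shows that this set is finite.\<close>

lemma sum_over_overlaps:
  "(\<Sum>V\<in>ordparts. \<Sum>W\<in>ordparts. factor (overlap V W)) / (real (card ordparts))\<^sup>2
    = (\<Sum>r\<in>overlap_matrices I I s s. pmf (overlap_law n I I s s) r * factor r)"
proof -
  let ?R = "overlap_matrices I I s s" and ?ov = "\<lambda>(V, W). overlap V W"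
  have fT: "finite (ordparts \<times> ordparts)" using fin by (simp add: finite_ordered_partitions)
  have im: "?ov ` (ordparts \<times> ordparts) = ?R"
  proof (intro equalityI subsetI)
    fix r assume "r \<in> ?ov ` (ordparts \<times> ordparts)"
    then show "r \<in> ?R" using overlap_in_overlap_matrices[OF _ _ fin fin] by auto
  next
    fix r assume "r \<in> ?R"
    from overlap_matrix_realized[OF this] show "r \<in> ?ov ` (ordparts \<times> ordparts)" by force
  qed
  have fR: "finite ?R" unfolding im[symmetric] using fT by (rule finite_imageI)
  have "(\<Sum>V\<in>ordparts. \<Sum>W\<in>ordparts. factor (overlap V W)) = (\<Sum>x\<in>ordparts \<times> ordparts. factor (?ov x))"
    by (simp add: sum.cartesian_product case_prod_beta)
  also have "\<dots> = (\<Sum>r\<in>?R. \<Sum>x\<in>{x \<in> ordparts \<times> ordparts. ?ov x = r}. factor (?ov x))"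
    by (rule sum.group[symmetric, OF fT fR]) (simp add: im)
  also have "\<dots> = (\<Sum>r\<in>?R. real (card {(V, W). V \<in> ordparts \<and> W \<in> ordparts \<and> overlap V W = r}) * factor r)"
  proof (intro sum.cong refl)
    fix r
    have "{x \<in> ordparts \<times> ordparts. ?ov x = r} = {(V, W). V \<in> ordparts \<and> W \<in> ordparts \<and> overlap V W = r}" by auto
    moreover have "(\<Sum>x\<in>{x \<in> ordparts \<times> ordparts. ?ov x = r}. factor (?ov x)) = (\<Sum>x\<in>{x \<in> ordparts \<times> ordparts. ?ov x = r}. factor r)"
      by (intro sum.cong refl) simp
    ultimately show "(\<Sum>x\<in>{x \<in> ordparts \<times> ordparts. ?ov x = r}. factor (?ov x))
        = real (card {(V, W). V \<in> ordparts \<and> W \<in> ordparts \<and> overlap V W = r}) * factor r"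
      by (simp only: sum_constant)
  qed
  finally show ?thesis
    by (simp add: pmf_overlap_law[OF fin fin n n] sum_divide_distrib power2_eq_square)
qed

text \<open>The ratio does not change when the count is scaled, so the number of size-preserving
  permutations drops out, and \<open>unit_weight\<close> cancels as well. What remains is the
  average of the factor over pairs of ordered partitions.\<close>

lemma second_moment_ratio:
  assumes Z: "\<And>G. real (Z G) = real (card {(P, D) \<in> signed_typed_partitions n I s. \<forall>C\<in>P. realizes G (D C) C})"
  shows "measure_pmf.expectation (random_graph n) (\<lambda>G. (real (Z G))\<^sup>2)
      / (measure_pmf.expectation (random_graph n) (\<lambda>G. real (Z G)))\<^sup>2
    = (\<Sum>r\<in>overlap_matrices I I s s. pmf (overlap_law n I I s s) r * factor r)"
proof -
  let ?E = "measure_pmf.expectation (random_graph n)"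
  let ?N = "real (card (size_perms I s))"
  have N: "?N \<noteq> 0"
    using finite_size_perms[OF fin] id_in_size_perms[of I s] by (auto simp: card_eq_0_iff)
  have ord: "ordered_count G = ?N * real (Z G)" for G
    unfolding Z by (rule ordered_signed_count[OF fin bspec[OF pos]])
  have "?E (\<lambda>G. (real (Z G))\<^sup>2) / (?E (\<lambda>G. real (Z G)))\<^sup>2
      = (?N\<^sup>2 * ?E (\<lambda>G. (real (Z G))\<^sup>2)) / (?N * ?E (\<lambda>G. real (Z G)))\<^sup>2"
    using N by (simp add: power_mult_distrib)
  also have "\<dots> = ?E (\<lambda>G. (ordered_count G)\<^sup>2) / (?E ordered_count)\<^sup>2"
    unfolding ord by (simp add: power_mult_distrib)
  also have "\<dots> = (\<Sum>V\<in>ordparts. \<Sum>W\<in>ordparts. factor (overlap V W)) * unit_weight\<^sup>2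
      / (real (card ordparts) * unit_weight)\<^sup>2"
    unfolding expectation_ordered_count_square expectation_ordered_count ..
  also have "\<dots> = (\<Sum>V\<in>ordparts. \<Sum>W\<in>ordparts. factor (overlap V W)) / (real (card ordparts))\<^sup>2"
    by (simp add: power_mult_distrib)
  finally show ?thesis unfolding sum_over_overlaps .
qed

end

lemma overlap_law_formula:
  assumes fin: "finite I" "finite J" and n: "(\<Sum>a\<in>I. s a) = n" "(\<Sum>b\<in>J. t b) = n"
    and r: "r \<in> overlap_matrices I J s t"
  shows "pmf (overlap_law n I J s t) r
    = (\<Prod>a\<in>I. fact (s a)) * (\<Prod>b\<in>J. fact (t b)) / (fact n * (\<Prod>a\<in>I. \<Prod>b\<in>J. fact (r a b)))"
  unfolding pmf_overlap_law[OF fin n] card_pairs_with_overlap[OF fin r n(1)]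
    card_ordered_partitions[OF fin(1) n(1)] card_ordered_partitions[OF fin(2) n(2)]
  by simp

section \<open>From the witness profile to slots\<close>

lemma class_size_inj:
  assumes "7 \<le> alpha n"
  shows "inj_on (class_size n) {2..5}"
  using assms by (intro inj_onI) (auto simp: class_size_def)

lemma finite_slots: "finite (slots k)"
  by (simp add: slots_def)

lemma sum_slots: "(\<Sum>a\<in>slots k. f (fst a)) = (\<Sum>i=2..5. nat (k i) * f i)"
proof -
  have "(\<Sum>a\<in>slots k. f (fst a)) = (\<Sum>i\<in>{2..5}. \<Sum>j\<in>{..<nat (k i)}. f i)"
    unfolding slots_def by (subst sum.Sigma) (auto simp: case_prod_beta)
  then show ?thesis by simp
qed

text \<open>Different types have different sizes, so a size identifies its type.\<close>

lemma card_slots_of_size: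
  assumes "7 \<le> alpha n" "i \<in> {2..5}"
  shows "card {a \<in> slots k. slot_size n a = class_size n i} = nat (k i)"
proof -
  have "{a \<in> slots k. slot_size n a = class_size n i} = {i} \<times> {..<nat (k i)}"
    using class_size_inj[OF assms(1)] assms(2) by (auto simp: slots_def slot_size_def inj_on_eq_iff)
  then show ?thesis by simp
qed

context
  fixes n :: nat and K :: int and k :: "nat \<Rightarrow> int"
  assumes valid: "valid_profile n K k"
begin

lemma valid_facts:
  "7 \<le> alpha n" "\<And>i. i \<in> {2..5} \<Longrightarrow> 0 \<le> k i" "(\<Sum>i=2..5. k i) = K"
  "(\<Sum>i=2..5. int (class_size n i) * k i) = int n"
  using valid by (auto simp: valid_profile_def)

lemma card_slots: "int (card (slots k)) = K"
proof -
  have "card (slots k) = (\<Sum>i=2..5. nat (k i))"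
    using sum_slots[of "\<lambda>_. 1" k] by simp
  then have "int (card (slots k)) = (\<Sum>i=2..5. int (nat (k i)))" by simp
  also have "\<dots> = (\<Sum>i=2..5. k i)" using valid_facts(2) by (intro sum.cong) auto
  finally show ?thesis using valid_facts(3) by simp
qed

lemma sum_nat_sizes: "(\<Sum>i=2..5. nat (k i) * class_size n i) = n"
proof -
  have "int (\<Sum>i=2..5. nat (k i) * class_size n i) = (\<Sum>i=2..5. int (class_size n i) * k i)"
    unfolding of_nat_sum using valid_facts(2) by (intro sum.cong refl) (simp add: mult.commute)
  then show ?thesis using valid_facts(4) by (simp only: of_nat_eq_iff)
qed

lemma sum_slot_size: "(\<Sum>a\<in>slots k. slot_size n a) = n"
  unfolding slot_size_def sum_slots by (rule sum_nat_sizes)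

lemma slot_size_pos: "a \<in> slots k \<Longrightarrow> 0 < slot_size n a"
  using valid_facts(1) by (auto simp: slots_def slot_size_def class_size_def)

text \<open>The left side prescribes the number of classes for four sizes only. These classes
  already contain \<open>n\<close> points, so any further class would have to be empty, and a
  partition has no empty class.\<close>

lemma signed_partitions_typed:
  "signed_partitions n k = signed_typed_partitions n (slots k) (slot_size n)"
proof -
  have "(\<forall>i\<in>{2..5}. int (card {C \<in> P. card C = class_size n i}) = k i)
      \<longleftrightarrow> (\<forall>u. card {C \<in> P. card C = u} = card {a \<in> slots k. slot_size n a = u})"
    if part: "partition_on {1..n} P" for P
  proof
    assume *: "\<forall>u. card {C \<in> P. card C = u} = card {a \<in> slots k. slot_size n a = u}"
    show "\<forall>i\<in>{2..5}. int (card {C \<in> P. card C = class_size n i}) = k i"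
      using * card_slots_of_size[OF valid_facts(1)] valid_facts(2) by simp
  next
    assume *: "\<forall>i\<in>{2..5}. int (card {C \<in> P. card C = class_size n i}) = k i"
    let ?P = "\<lambda>i. {C \<in> P. card C = class_size n i}"
    have finP: "finite P" using part by (rule finite_elements[rotated]) simp
    have finC: "finite C" "C \<noteq> {}" if "C \<in> P" for C
    proof -
      have "C \<subseteq> {1..n}" using that partition_onD1[OF part] by blast
      then show "finite C" by (rule finite_subset) simp
      show "C \<noteq> {}" using that partition_onD3[OF part] by blast
    qed
    have card_P: "card (?P i) = nat (k i)" if "i \<in> {2..5}" for i
    proof -
      have "int (card (?P i)) = k i" using * that by (rule bspec)
      then show ?thesis by linarith
    qed
    \<comment> \<open>Count the points class by class, with the prescribed sizes separated from the
      rest; injectivity of \<open>class_size n\<close> keeps the four groups apart.\<close>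
    have "n = card (\<Union>P)" by (simp flip: partition_onD1[OF part])
    also have "\<dots> = (\<Sum>C\<in>P. card C)"
      using partition_onD2[OF part] finC(1) by (intro card_Union_disjoint)
    also have "\<dots> = (\<Sum>C\<in>(\<Union>i\<in>{2..5}. ?P i). card C) + (\<Sum>C\<in>P - (\<Union>i\<in>{2..5}. ?P i). card C)"
      using finP by (subst add.commute, intro sum.subset_diff) auto
    also have "(\<Sum>C\<in>(\<Union>i\<in>{2..5}. ?P i). card C) = (\<Sum>i=2..5. \<Sum>C\<in>?P i. card C)"
      using finP class_size_inj[OF valid_facts(1)]
      by (intro sum.UNION_disjoint) (auto simp: inj_on_eq_iff)
    also have "\<dots> = (\<Sum>i=2..5. nat (k i) * class_size n i)"
    proof (intro sum.cong refl)
      fix i :: nat assume "i \<in> {2..5}"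
      then have "card (?P i) = nat (k i)" by (rule card_P)
      then show "(\<Sum>C\<in>?P i. card C) = nat (k i) * class_size n i" by simp
    qed
    finally have "(\<Sum>C\<in>P - (\<Union>i\<in>{2..5}. ?P i). card C) = 0"
      unfolding sum_nat_sizes by simp
    then have zero: "card C = 0" if "C \<in> P - (\<Union>i\<in>{2..5}. ?P i)" for C
      using that finP by (subst (asm) sum_eq_0_iff) blast+
    have cover: "C \<in> (\<Union>i\<in>{2..5}. ?P i)" if "C \<in> P" for C
    proof (rule ccontr)
      assume "C \<notin> (\<Union>i\<in>{2..5}. ?P i)"
      then have "card C = 0" using that by (intro zero) blast
      then show False using finC[OF that] by simp
    qed
    have other: "card {C \<in> P. card C = u} = card {a \<in> slots k. slot_size n a = u}"
      if "u \<notin> class_size n ` {2..5}" for u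
    proof -
      have "{C \<in> P. card C = u} = {}"
        using that cover by blast
      moreover have "{a \<in> slots k. slot_size n a = u} = {}"
        using that by (auto simp: slots_def slot_size_def)
      ultimately show ?thesis by (simp only: card.empty)
    qed
    show "\<forall>u. card {C \<in> P. card C = u} = card {a \<in> slots k. slot_size n a = u}"
    proof
      fix u
      show "card {C \<in> P. card C = u} = card {a \<in> slots k. slot_size n a = u}"
      proof (cases "u \<in> class_size n ` {2..5}")
        case True
        then obtain i where i: "i \<in> {2..5}" "u = class_size n i" by blast
        show ?thesis
          unfolding i(2) card_slots_of_size[OF valid_facts(1) i(1)] by (rule card_P[OF i(1)])
      qed (rule other)
    qed
  qed
  then have "partition_on {1..n} P \<and> (\<forall>i\<in>{2..5}. int (card {C \<in> P. card C = class_size n i}) = k i)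
      \<longleftrightarrow> partition_on {1..n} P \<and> (\<forall>u. card {C \<in> P. card C = u} = card {a \<in> slots k. slot_size n a = u})"
    for P by (rule conj_cong[OF refl])
  then show ?thesis
    unfolding signed_partitions_def signed_typed_partitions_def typed_partitions_def
    by (simp only: mem_Collect_eq conj_assoc[symmetric])
qed

end

theorem lemma6p1:
  fixes A_star :: real
  assumes A_star_pos: "A_star > 0"
    and A_star_unique_zero: "\<forall>\<^sub>F n in sequentially. \<exists>!k. is_window_zero A_star n k"
  shows "\<forall>\<^sub>F n in sequentially. \<forall>k. exact_signed_witness_profile A_star n k \<longrightarrow>
    (let I_row = slots k; I_col = slots k; s = slot_size n; t = slot_size n;
         R = overlap_matrices I_row I_col s t;
         A = A_zeta n (k_co A_star n) I_row I_col s t;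
         p = pmf (overlap_law n I_row I_col s t);
         \<mu> = random_graph n
     in (\<forall>r\<in>R.
           (\<forall>V\<in>ordered_partitions n I_row s. \<forall>W\<in>ordered_partitions n I_col t.
              overlap V W = r \<longrightarrow>
              pair_local_factor n (k_co A_star n) I_row I_col V W = A r)
         \<and> A r = 2 powi (int (overlap_weight I_row I_col r) + int (card (H_components r))
                          - int (card (H_vertices r)))
         \<and> A r = (\<Prod>a\<in>I_row. \<Prod>b\<in>I_col. g_weight (r a b)) * 2 powi (H_beta r))
      \<and> measure_pmf.expectation \<mu> (\<lambda>G. (real (Z_sgn n k G))\<^sup>2)
          / (measure_pmf.expectation \<mu> (\<lambda>G. real (Z_sgn n k G)))\<^sup>2
        = (\<Sum>r\<in>R. p r * A r)
      \<and> (\<forall>r\<in>R. p r = (\<Prod>a\<in>I_row. fact (s a)) * (\<Prod>b\<in>I_col. fact (t b))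
                     / (fact n * (\<Prod>a\<in>I_row. \<Prod>b\<in>I_col. fact (r a b)))))"
  using witness_profile_valid[OF A_star_pos A_star_unique_zero]
proof eventually_elim
  case (elim n)
  show ?case
    unfolding Let_def
  proof (intro allI impI conjI ballI)
    fix k assume prof: "exact_signed_witness_profile A_star n k"
    let ?K = "k_co A_star n" and ?I = "slots k" and ?s = "slot_size n"
    let ?R = "overlap_matrices ?I ?I ?s ?s"
    \<comment> \<open>From here on the profile is used only through
      \<open>valid_profile\<close>.\<close>
    have valid: "valid_profile n ?K k" using elim prof by blast
    note fin = finite_slots[of k]
    note n = sum_slot_size[OF valid]
    have pos: "\<forall>a\<in>?I. 0 < ?s a" using slot_size_pos[OF valid] by blast
    have K: "?K = int (card ?I)" using card_slots[OF valid] by simp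
    note A = A_zeta_factor[OF fin n pos, folded K]
    {
      fix r assume r: "r \<in> ?R"
      show "A_zeta n ?K ?I ?I ?s ?s r = 2 powi (int (overlap_weight ?I ?I r)
          + int (card (H_components r)) - int (card (H_vertices r)))"
        by (rule A[OF r])
      then show "A_zeta n ?K ?I ?I ?s ?s r = (\<Prod>a\<in>?I. \<Prod>b\<in>?I. g_weight (r a b)) * 2 powi (H_beta r)"
        by (rule trans[OF _ overlap_weight_beta[OF fin fin H_edges_subset[OF r]]])
      show "pmf (overlap_law n ?I ?I ?s ?s) r = (\<Prod>a\<in>?I. fact (?s a)) * (\<Prod>b\<in>?I. fact (?s b))
          / (fact n * (\<Prod>a\<in>?I. \<Prod>b\<in>?I. fact (r a b)))"
        by (rule overlap_law_formula[OF fin fin n n r])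
      \<comment> \<open>Independence of the chosen pair: every pair with matrix \<open>r\<close> has
        the closed form already shown for the pair selected in \<open>A_zeta\<close>.\<close>
      fix V W assume VW: "V \<in> ordered_partitions n ?I ?s" "W \<in> ordered_partitions n ?I ?s" "overlap V W = r"
      show "pair_local_factor n ?K ?I ?I V W = A_zeta n ?K ?I ?I ?s ?s r"
        unfolding pair_local_factor_overlap[OF fin n pos VW(1,2), folded K] VW(3)
        by (rule A[OF r, symmetric])
    }
    have Z: "real (Z_sgn n k G)
        = real (card {(P, D) \<in> signed_typed_partitions n ?I ?s. \<forall>C\<in>P. realizes G (D C) C})" for G
      by (simp add: Z_sgn_def signed_partitions_typed[OF valid])
    have "measure_pmf.expectation (random_graph n) (\<lambda>G. (real (Z_sgn n k G))\<^sup>2)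
          / (measure_pmf.expectation (random_graph n) (\<lambda>G. real (Z_sgn n k G)))\<^sup>2
        = (\<Sum>r\<in>?R. pmf (overlap_law n ?I ?I ?s ?s) r * (2 powi (int (overlap_weight ?I ?I r)
            + int (card (H_components r)) - int (card (H_vertices r)))))"
      by (rule second_moment_ratio[OF fin n pos Z])
    also have "\<dots> = (\<Sum>r\<in>?R. pmf (overlap_law n ?I ?I ?s ?s) r * A_zeta n ?K ?I ?I ?s ?s r)"
    proof (intro sum.cong refl)
      fix r assume "r \<in> ?R"
      then show "pmf (overlap_law n ?I ?I ?s ?s) r * (2 powi (int (overlap_weight ?I ?I r)
            + int (card (H_components r)) - int (card (H_vertices r))))
          = pmf (overlap_law n ?I ?I ?s ?s) r * A_zeta n ?K ?I ?I ?s ?s r"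
        by (intro arg_cong2[where f = "(*)"] refl A[symmetric])
    qed
    finally show "measure_pmf.expectation (random_graph n) (\<lambda>G. (real (Z_sgn n k G))\<^sup>2)
          / (measure_pmf.expectation (random_graph n) (\<lambda>G. real (Z_sgn n k G)))\<^sup>2
        = (\<Sum>r\<in>?R. pmf (overlap_law n ?I ?I ?s ?s) r * A_zeta n ?K ?I ?I ?s ?s r)" .
  qed
qed

end
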